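(* Let $E$ be a finite directed graph with no sinks or sources. Let $(G,E)$ be a contracting self-similar groupoid action. Let $\mathcal{J}$ be the limit space of $(G,E)$, and let $\tilde\sigma:\mathcal{J}\to\mathcal{J}$ be the map $\tilde\sigma([x])=[\sigma(x)]$ induced by the shift $\sigma$ on $E^{-\infty}$. Let $\mathcal{J}_\infty:=\varprojlim(\mathcal{J},\tilde\sigma)$, and let $\tilde\sigma_\infty:\mathcal{J}_\infty\to\mathcal{J}_\infty$ be the homeomorphism $\tilde\sigma_\infty(\xi_1,\xi_2,\dots)=(\tilde\sigma(\xi_1),\xi_1,\xi_2,\dots)$. Let $\mathcal{S}=E^{\mathbb{Z}}/{\sim_{ae}}$ be the limit solenoid of $(G,E)$. Then there is a homeomorphism $\theta:\mathcal{S}\to\mathcal{J}_\infty$ such that $\theta([x])=([x(-\infty,-1)],[x(-\infty,0)],[x(-\infty,1)],\dots)$ for all $x\in E^{\mathbb{Z}}$. We have $\theta([\tau(x)])=\tilde\sigma_\infty(\theta([x]))$ for all $x\in E^{\mathbb{Z}}$.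
   Context: **Graphs.** A directed graph is $E=(E^0,E^1,r,s)$ with $r,s:E^1\to E^0$. Paths are $\mu=e_1\cdots e_n$ with $s(e_i)=r(e_{i+1})$; $r(\mu)=r(e_1)$, $s(\mu)=s(e_n)$; $E^n$ is the set of paths of length $n$, $E^*=\bigcup_nE^n$; $vE^*$, $vE^n$ denote the paths with range $v$. No sources: $vE^1\ne\emptyset$ for all $v$; no sinks: $\{e:s(e)=v\}\neq\emptyset$ for all $v$. $E^{-\infty}$ and $E^{\mathbb{Z}}$ are the left-infinite ($\cdots e_{-2}e_{-1}$) and bi-infinite paths ($s(e_i)=r(e_{i+1})$ for all $i$), with cylinder-set topologies. **Self-similar groupoid actions.** A partial isomorphism of $E^*$ is a length-preserving bijection $g:vE^*\to wE^*$ with $g(\mu e)\in g(\mu)E^1$; $d(g)=v$, $c(g)=w$. These form a groupoid $\mathrm{PIso}(E^* )$ with unit space $E^0$. A self-similar groupoid action $(G,E)$ is a groupoid $G$ with unit space $E^0$ and an injective homomorphism $G\to\mathrm{PIso}(E^* )$, identity on $E^0$ (written $g\cdot\mu$), such that for all $g\in G$, $e\in d(g)E^1$ there is a (necessarily unique) $g|_e\in G$ with $d(g|_e)=s(e)$, $c(g|_e)=s(g\cdot e)$, $g\cdot(e\mu)=(g\cdot e)(g|_e\cdot\mu)$ for all $\mu\in s(e)E^*$. Put $g|_{d(g)}=g$, $g|_{e\mu}=(g|_e)|_\mu$. $G$ acts on right-infinite paths via initial segments. Contracting: there is a finite $F\subseteq G$ such that for every $g\in G$ there is $n\ge0$ with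 $\{g|_\mu:\mu\in d(g)E^n\}\subseteq F$. **Limit space and solenoid.** For $x,y\in E^{-\infty}$, $x\sim_{ae}y$ if there is $(g_n)_{n<0}$ in $G$ with finitely many values and $g_n\cdot(x_n\cdots x_{-1})=y_n\cdots y_{-1}$ for all $n<0$; $\mathcal{J}=E^{-\infty}/{\sim_{ae}}$ with the quotient topology; $\sigma(\cdots x_{-3}x_{-2}x_{-1})=\cdots x_{-3}x_{-2}$. For $x,y\in E^{\mathbb{Z}}$, $x\sim_{ae}y$ if there is $(g_n)_{n\in\mathbb{Z}}$ in $G$ with finitely many values and $g_n\cdot(x_nx_{n+1}\cdots)=y_ny_{n+1}\cdots$ for all $n\in\mathbb{Z}$; $\mathcal{S}=E^{\mathbb{Z}}/{\sim_{ae}}$ with the quotient topology. $\tau(x)_n=x_{n-1}$ for $x\in E^{\mathbb{Z}}$. For $x\in E^{\mathbb{Z}}$, $x(-\infty,n)=\cdots x_{n-2}x_{n-1}x_n$, regarded as an element of $E^{-\infty}$ (re-indexed so its last edge has index $-1$). $\varprojlim(X,g)=\{(x_n)_{n\ge1}: x_n\in X,\ g(x_{n+1})=x_n\text{ for all }n\}$ with the subspace topology from the product. *)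

theory Defs
  imports "HOL-Analysis.Analysis" "Graph_Theory.Digraph"
begin

section \<open>Paths\<close>

text \<open>
  A directed graph \<open>(E\<^sup>0, E\<^sup>1, r, s)\<close> is a \<^typ>\<open>('v, 'e) pre_digraph\<close> with
  \<open>E\<^sup>0 = verts E\<close>, \<open>E\<^sup>1 = arcs E\<close>, \<open>r = head E\<close> and \<open>s = tail E\<close>.  Paths are composed as
  functions: consecutive edges satisfy \<open>s(e\<^sub>i) = r(e\<^sub>i\<^sub>+\<^sub>1)\<close>, so the walks of the graph library
  run in the opposite direction and are not used.
\<close>

definition no_sources :: "('v, 'e) pre_digraph \<Rightarrow> bool" where
  "no_sources E \<longleftrightarrow> (\<forall>v\<in>verts E. \<exists>e\<in>arcs E. head E e = v)"

definition no_sinks :: "('v, 'e) pre_digraph \<Rightarrow> bool" where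
  "no_sinks E \<longleftrightarrow> (\<forall>v\<in>verts E. \<exists>e\<in>arcs E. tail E e = v)"

text \<open>
  \<open>vE\<^sup>*\<close>.  An element is given by its list of edges; the path \<open>v\<close> of length zero in \<open>vE\<^sup>*\<close> is
  \<open>[]\<close>, the vertex being remembered by the index \<open>v\<close>.
\<close>

definition paths_to :: "('v, 'e) pre_digraph \<Rightarrow> 'v \<Rightarrow> 'e list set" where
  "paths_to E v = {p. set p \<subseteq> arcs E \<and> (p \<noteq> [] \<longrightarrow> head E (hd p) = v) \<and>
     (\<forall>i. Suc i < length p \<longrightarrow> tail E (p ! i) = head E (p ! Suc i))}"

section \<open>Self-similar groupoid actions\<close>

record ('g, 'v) groupoid =
  arrows :: "'g set"
  gdom :: "'g \<Rightarrow> 'v"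
  gcod :: "'g \<Rightarrow> 'v"
  gunit :: "'v \<Rightarrow> 'g"
  gcomp :: "'g \<Rightarrow> 'g \<Rightarrow> 'g"

text \<open>
  A groupoid with unit space \<open>X\<close>; the unit at \<open>x \<in> X\<close> is the arrow \<open>gunit G x\<close>, and
  \<open>gcomp G g h\<close> is the product \<open>gh\<close>, which is meaningful when \<open>d(g) = c(h)\<close>.
\<close>

locale groupoid =
  fixes X :: "'v set" and G :: "('g, 'v) groupoid"
  assumes gdom_in: "g \<in> arrows G \<Longrightarrow> gdom G g \<in> X"
    and gcod_in: "g \<in> arrows G \<Longrightarrow> gcod G g \<in> X"
    and gunit_in: "x \<in> X \<Longrightarrow> gunit G x \<in> arrows G"
    and gdom_gunit: "x \<in> X \<Longrightarrow> gdom G (gunit G x) = x"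
    and gcod_gunit: "x \<in> X \<Longrightarrow> gcod G (gunit G x) = x"
    and gcomp_in: "\<lbrakk>g \<in> arrows G; h \<in> arrows G; gdom G g = gcod G h\<rbrakk> \<Longrightarrow> gcomp G g h \<in> arrows G"
    and gdom_gcomp: "\<lbrakk>g \<in> arrows G; h \<in> arrows G; gdom G g = gcod G h\<rbrakk>
      \<Longrightarrow> gdom G (gcomp G g h) = gdom G h"
    and gcod_gcomp: "\<lbrakk>g \<in> arrows G; h \<in> arrows G; gdom G g = gcod G h\<rbrakk>
      \<Longrightarrow> gcod G (gcomp G g h) = gcod G g"
    and gcomp_assoc: "\<lbrakk>g \<in> arrows G; h \<in> arrows G; k \<in> arrows G; gdom G g = gcod G h;
      gdom G h = gcod G k\<rbrakk> \<Longrightarrow> gcomp G (gcomp G g h) k = gcomp G g (gcomp G h k)"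
    and gcomp_gunit_left: "g \<in> arrows G \<Longrightarrow> gcomp G (gunit G (gcod G g)) g = g"
    and gcomp_gunit_right: "g \<in> arrows G \<Longrightarrow> gcomp G g (gunit G (gdom G g)) = g"
    and ginverse_ex: "g \<in> arrows G \<Longrightarrow> \<exists>h\<in>arrows G. gdom G h = gcod G g \<and> gcod G h = gdom G g \<and>
      gcomp G h g = gunit G (gdom G g) \<and> gcomp G g h = gunit G (gcod G g)"

text \<open>\<open>f : vE\<^sup>* \<rightarrow> wE\<^sup>*\<close> is an element of \<open>PIso(E\<^sup>*)\<close>; only its values on \<open>vE\<^sup>*\<close> matter.\<close>

definition partial_iso ::
    "('v, 'e) pre_digraph \<Rightarrow> 'v \<Rightarrow> 'v \<Rightarrow> ('e list \<Rightarrow> 'e list) \<Rightarrow> bool" where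
  "partial_iso E v w f \<longleftrightarrow> v \<in> verts E \<and> w \<in> verts E \<and>
     bij_betw f (paths_to E v) (paths_to E w) \<and>
     (\<forall>p\<in>paths_to E v. length (f p) = length p) \<and>
     (\<forall>p e. p @ [e] \<in> paths_to E v \<longrightarrow> (\<exists>e'\<in>arcs E. f (p @ [e]) = f p @ [e']))"

text \<open>
  \<open>act g\<close> is the map \<open>\<mu> \<mapsto> g \<cdot> \<mu>\<close> on \<open>d(g)E\<^sup>*\<close>; the list \<open>act g [e]\<close> is the edge \<open>g \<cdot> e\<close>.
  The predicate below says that \<open>h = g|\<^sub>e\<close>.
\<close>

definition is_edge_restriction :: "('v, 'e) pre_digraph \<Rightarrow> ('g, 'v) groupoid \<Rightarrow>
    ('g \<Rightarrow> 'e list \<Rightarrow> 'e list) \<Rightarrow> 'g \<Rightarrow> 'e \<Rightarrow> 'g \<Rightarrow> bool" where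
  "is_edge_restriction E G act g e h \<longleftrightarrow> h \<in> arrows G \<and> gdom G h = tail E e \<and>
     gcod G h = tail E (hd (act g [e])) \<and>
     (\<forall>p\<in>paths_to E (tail E e). act g (e # p) = act g [e] @ act h p)"

text \<open>
  The homomorphism \<open>G \<rightarrow> PIso(E\<^sup>*)\<close> sends \<open>g\<close> to the partial isomorphism with domain \<open>d(g)\<close>,
  codomain \<open>c(g)\<close> and underlying map \<open>act g\<close> restricted to \<open>d(g)E\<^sup>*\<close>.
\<close>

locale self_similar_groupoid_action = groupoid "verts E" G
  for E :: "('v, 'e) pre_digraph" and G :: "('g, 'v) groupoid" +
  fixes act :: "'g \<Rightarrow> 'e list \<Rightarrow> 'e list"
  assumes act_piso: "g \<in> arrows G \<Longrightarrow> partial_iso E (gdom G g) (gcod G g) (act g)"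
    and act_gunit: "\<lbrakk>v \<in> verts E; p \<in> paths_to E v\<rbrakk> \<Longrightarrow> act (gunit G v) p = p"
    and act_gcomp: "\<lbrakk>g \<in> arrows G; h \<in> arrows G; gdom G g = gcod G h; p \<in> paths_to E (gdom G h)\<rbrakk>
      \<Longrightarrow> act (gcomp G g h) p = act g (act h p)"
    and act_inj: "inj_on (\<lambda>g. (gdom G g, gcod G g, restrict (act g) (paths_to E (gdom G g))))
      (arrows G)"
    and edge_restriction_ex: "\<lbrakk>g \<in> arrows G; e \<in> arcs E; head E e = gdom G g\<rbrakk>
      \<Longrightarrow> \<exists>h. is_edge_restriction E G act g e h"

definition edge_restriction :: "('v, 'e) pre_digraph \<Rightarrow> ('g, 'v) groupoid \<Rightarrow>
    ('g \<Rightarrow> 'e list \<Rightarrow> 'e list) \<Rightarrow> 'g \<Rightarrow> 'e \<Rightarrow> 'g" where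
  "edge_restriction E G act g e = (THE h. is_edge_restriction E G act g e h)"

definition path_restriction :: "('v, 'e) pre_digraph \<Rightarrow> ('g, 'v) groupoid \<Rightarrow>
    ('g \<Rightarrow> 'e list \<Rightarrow> 'e list) \<Rightarrow> 'g \<Rightarrow> 'e list \<Rightarrow> 'g" where
  "path_restriction E G act g p = foldl (edge_restriction E G act) g p"

definition contracting :: "('v, 'e) pre_digraph \<Rightarrow> ('g, 'v) groupoid \<Rightarrow>
    ('g \<Rightarrow> 'e list \<Rightarrow> 'e list) \<Rightarrow> bool" where
  "contracting E G act \<longleftrightarrow> (\<exists>F. finite F \<and> F \<subseteq> arrows G \<and>
     (\<forall>g\<in>arrows G. \<exists>n. {path_restriction E G act g p |p.
        p \<in> paths_to E (gdom G g) \<and> length p = n} \<subseteq> F))"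

text \<open>
  The action on right-infinite paths \<open>z\<^sub>0z\<^sub>1z\<^sub>2\<dots>\<close> with \<open>r(z\<^sub>0) = d(g)\<close>: the \<open>k\<close>-th edge of
  \<open>g \<cdot> z\<close> is the last edge of \<open>g \<cdot> (z\<^sub>0\<dots>z\<^sub>k)\<close>.
\<close>

definition act_right_inf :: "('g \<Rightarrow> 'e list \<Rightarrow> 'e list) \<Rightarrow> 'g \<Rightarrow> (nat \<Rightarrow> 'e) \<Rightarrow> nat \<Rightarrow> 'e" where
  "act_right_inf act g z = (\<lambda>k. last (act g (map z [0..<Suc k])))"

section \<open>Infinite paths\<close>

text \<open>
  \<open>E\<^sup>-\<^sup>\<infinity>\<close>: functions on the negative integers (extended by \<^term>\<open>undefined\<close>).  The topologies are
  generated by the cylinder sets of the finite paths.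
\<close>

definition left_inf_paths :: "('v, 'e) pre_digraph \<Rightarrow> (int \<Rightarrow> 'e) set" where
  "left_inf_paths E = {x \<in> {..<0} \<rightarrow>\<^sub>E arcs E. \<forall>n < -1. tail E (x n) = head E (x (n + 1))}"

definition bi_inf_paths :: "('v, 'e) pre_digraph \<Rightarrow> (int \<Rightarrow> 'e) set" where
  "bi_inf_paths E = {x. range x \<subseteq> arcs E \<and> (\<forall>n. tail E (x n) = head E (x (n + 1)))}"

definition left_inf_topology :: "('v, 'e) pre_digraph \<Rightarrow> (int \<Rightarrow> 'e) topology" where
  "left_inf_topology E = topology_generated_by
     {{x \<in> left_inf_paths E. map x [- int (length p)..-1] = p} |p. p \<in> (\<Union>v\<in>verts E. paths_to E v)}"

definition bi_inf_topology :: "('v, 'e) pre_digraph \<Rightarrow> (int \<Rightarrow> 'e) topology" where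
  "bi_inf_topology E = topology_generated_by
     {{x \<in> bi_inf_paths E. map x [m..m + int (length p) - 1] = p} |m p.
        p \<in> (\<Union>v\<in>verts E. paths_to E v)}"

definition left_shift :: "(int \<Rightarrow> 'e) \<Rightarrow> int \<Rightarrow> 'e" where
  "left_shift x = (\<lambda>n\<in>{..<0}. x (n - 1))"

definition bi_shift :: "(int \<Rightarrow> 'e) \<Rightarrow> int \<Rightarrow> 'e" where
  "bi_shift x = (\<lambda>n. x (n - 1))"

text \<open>\<open>x(-\<infinity>, n)\<close>, re-indexed so that its last edge \<open>x\<^sub>n\<close> has index \<open>-1\<close>.\<close>

definition left_part :: "(int \<Rightarrow> 'e) \<Rightarrow> int \<Rightarrow> int \<Rightarrow> 'e" where
  "left_part x n = (\<lambda>k\<in>{..<0}. x (n + 1 + k))"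

section \<open>Limit space and limit solenoid\<close>

definition quotient_topology :: "'a topology \<Rightarrow> ('a \<times> 'a) set \<Rightarrow> 'a set topology" where
  "quotient_topology X R =
     topology (\<lambda>U. U \<subseteq> topspace X // R \<and> openin X {x \<in> topspace X. R `` {x} \<in> U})"

text \<open>
  In both relations \<open>g\<^sub>n\<close> has to be applicable to the path in question, that is
  \<open>d(g\<^sub>n) = r(x\<^sub>n)\<close>.
\<close>

definition ae_left :: "('v, 'e) pre_digraph \<Rightarrow> ('g, 'v) groupoid \<Rightarrow>
    ('g \<Rightarrow> 'e list \<Rightarrow> 'e list) \<Rightarrow> ((int \<Rightarrow> 'e) \<times> (int \<Rightarrow> 'e)) set" where
  "ae_left E G act = {(x, y). x \<in> left_inf_paths E \<and> y \<in> left_inf_paths E \<and>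
     (\<exists>g. g ` {..<0} \<subseteq> arrows G \<and> finite (g ` {..<0}) \<and>
        (\<forall>n<0::int. gdom G (g n) = head E (x n) \<and> act (g n) (map x [n..-1]) = map y [n..-1]))}"

definition ae_bi :: "('v, 'e) pre_digraph \<Rightarrow> ('g, 'v) groupoid \<Rightarrow>
    ('g \<Rightarrow> 'e list \<Rightarrow> 'e list) \<Rightarrow> ((int \<Rightarrow> 'e) \<times> (int \<Rightarrow> 'e)) set" where
  "ae_bi E G act = {(x, y). x \<in> bi_inf_paths E \<and> y \<in> bi_inf_paths E \<and>
     (\<exists>g. range g \<subseteq> arrows G \<and> finite (range g) \<and>
        (\<forall>n::int. gdom G (g n) = head E (x n) \<and>
           act_right_inf act (g n) (\<lambda>k. x (n + int k)) = (\<lambda>k. y (n + int k))))}"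

definition limit_space :: "('v, 'e) pre_digraph \<Rightarrow> ('g, 'v) groupoid \<Rightarrow>
    ('g \<Rightarrow> 'e list \<Rightarrow> 'e list) \<Rightarrow> (int \<Rightarrow> 'e) set topology" where
  "limit_space E G act = quotient_topology (left_inf_topology E) (ae_left E G act)"

definition limit_solenoid :: "('v, 'e) pre_digraph \<Rightarrow> ('g, 'v) groupoid \<Rightarrow>
    ('g \<Rightarrow> 'e list \<Rightarrow> 'e list) \<Rightarrow> (int \<Rightarrow> 'e) set topology" where
  "limit_solenoid E G act = quotient_topology (bi_inf_topology E) (ae_bi E G act)"

text \<open>The induced map \<open>[x] \<mapsto> [\<sigma>(x)]\<close>; see \<open>limit_shift_class\<close> below.\<close>

definition limit_shift :: "('v, 'e) pre_digraph \<Rightarrow> ('g, 'v) groupoid \<Rightarrow>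
    ('g \<Rightarrow> 'e list \<Rightarrow> 'e list) \<Rightarrow> (int \<Rightarrow> 'e) set \<Rightarrow> (int \<Rightarrow> 'e) set" where
  "limit_shift E G act C = (\<Union>x\<in>C. ae_left E G act `` {left_shift x})"

definition inverse_limit :: "'a topology \<Rightarrow> ('a \<Rightarrow> 'a) \<Rightarrow> (nat \<Rightarrow> 'a) topology" where
  "inverse_limit X f = subtopology (product_topology (\<lambda>_. X) {1..}) {\<xi>. \<forall>n\<ge>1. f (\<xi> (n + 1)) = \<xi> n}"

definition inverse_limit_shift :: "('a \<Rightarrow> 'a) \<Rightarrow> (nat \<Rightarrow> 'a) \<Rightarrow> nat \<Rightarrow> 'a" where
  "inverse_limit_shift f \<xi> = (\<lambda>n\<in>{1..}. if n = 1 then f (\<xi> 1) else \<xi> (n - 1))"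

section \<open>Well-definedness\<close>

lemma openin_quotient_topology:
  "openin (quotient_topology X R) U \<longleftrightarrow>
     U \<subseteq> topspace X // R \<and> openin X {x \<in> topspace X. R `` {x} \<in> U}"
proof -
  let ?P = "\<lambda>U. U \<subseteq> topspace X // R \<and> openin X {x \<in> topspace X. R `` {x} \<in> U}"
  have 1: "?P (S \<inter> T)" if "?P S" "?P T" for S T
  proof -
    have "{x \<in> topspace X. R `` {x} \<in> S \<inter> T}
      = {x \<in> topspace X. R `` {x} \<in> S} \<inter> {x \<in> topspace X. R `` {x} \<in> T}" by auto
    then have "openin X {x \<in> topspace X. R `` {x} \<in> S \<inter> T}" using that by (simp only: openin_Int)
    with that show ?thesis by blast
  qed
  have 2: "?P (\<Union>\<K>)" if "\<forall>K\<in>\<K>. ?P K" for \<K>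
  proof -
    have "{x \<in> topspace X. R `` {x} \<in> \<Union>\<K>} = (\<Union>K\<in>\<K>. {x \<in> topspace X. R `` {x} \<in> K})" by auto
    with that show ?thesis by (auto intro!: openin_Union)
  qed
  have "istopology ?P"
    unfolding istopology_def using 1 2 by blast
  then show ?thesis
    unfolding quotient_topology_def by simp
qed

lemma quotient_map_quotient_topology:
  "quotient_map X (quotient_topology X R) (\<lambda>x. R `` {x})"
proof -
  have "openin (quotient_topology X R) (topspace X // R)"
  proof -
    have "{x \<in> topspace X. R `` {x} \<in> topspace X // R} = topspace X"
      by (auto intro: quotientI)
    then show ?thesis by (simp add: openin_quotient_topology)
  qed
  then have "topspace (quotient_topology X R) = topspace X // R"
    by (metis openin_quotient_topology openin_subset openin_topspace subset_antisym)
  moreover have "(\<lambda>x. R `` {x}) ` topspace X = topspace X // R"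
    by (auto simp: quotient_def)
  ultimately show ?thesis
    by (simp add: quotient_map_def openin_quotient_topology)
qed

lemma topspace_left_inf_topology:
  fixes E :: "('v, 'e) pre_digraph"
  assumes "wf_digraph E"
  shows "topspace (left_inf_topology E) = left_inf_paths E"
proof
  show "topspace (left_inf_topology E) \<subseteq> left_inf_paths E"
    unfolding left_inf_topology_def topology_generated_by_topspace by blast
  show "left_inf_paths E \<subseteq> topspace (left_inf_topology E)"
  proof
    fix x assume x: "x \<in> left_inf_paths E"
    then have "x (-1) \<in> arcs E" by (auto simp: left_inf_paths_def PiE_def Pi_def)
    then have v: "head E (x (-1)) \<in> verts E" by (rule wf_digraph.head_in_verts[OF assms])
    have p: "[] \<in> paths_to E (head E (x (-1)))" by (simp add: paths_to_def)
    have "openin (left_inf_topology E) {x \<in> left_inf_paths E. map x [- int (length ([] :: 'e list))..-1] = []}"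
      unfolding left_inf_topology_def
      by (rule topology_generated_by_Basis, rule CollectI, rule exI[of _ "[]"]) (rule conjI, rule refl, rule UN_I, rule v, rule p)
    moreover have "x \<in> {x \<in> left_inf_paths E. map x [- int (length ([] :: 'e list))..-1] = []}" using x by simp
    ultimately show "x \<in> topspace (left_inf_topology E)" by (meson openin_subset subsetD)
  qed
qed

lemma topspace_bi_inf_topology:
  fixes E :: "('v, 'e) pre_digraph"
  assumes "wf_digraph E"
  shows "topspace (bi_inf_topology E) = bi_inf_paths E"
proof
  show "topspace (bi_inf_topology E) \<subseteq> bi_inf_paths E"
    unfolding bi_inf_topology_def topology_generated_by_topspace by blast
  show "bi_inf_paths E \<subseteq> topspace (bi_inf_topology E)"
  proof
    fix x assume x: "x \<in> bi_inf_paths E"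
    then have "x (-1) \<in> arcs E" by (auto simp: bi_inf_paths_def)
    then have v: "head E (x (-1)) \<in> verts E" by (rule wf_digraph.head_in_verts[OF assms])
    have p: "[] \<in> paths_to E (head E (x (-1)))" by (simp add: paths_to_def)
    have "openin (bi_inf_topology E) {x \<in> bi_inf_paths E. map x [0..0 + int (length ([] :: 'e list)) - 1] = []}"
      unfolding bi_inf_topology_def
      by (rule topology_generated_by_Basis, rule CollectI, rule exI[of _ 0], rule exI[of _ "[]"]) (rule conjI, rule refl, rule UN_I, rule v, rule p)
    moreover have "x \<in> {x \<in> bi_inf_paths E. map x [0..0 + int (length ([] :: 'e list)) - 1] = []}" using x by simp
    ultimately show "x \<in> topspace (bi_inf_topology E)" by (meson openin_subset subsetD)
  qed
qed

lemma left_shift_in: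
  assumes "x \<in> left_inf_paths E" shows "left_shift x \<in> left_inf_paths E"
proof -
  have t: "tail E (x n) = head E (x (n + 1))" if "n < -1" for n
    using assms that by (auto simp: left_inf_paths_def)
  have a: "x n \<in> arcs E" if "n < 0" for n
    using assms that by (auto simp: left_inf_paths_def PiE_def Pi_def)
  have "tail E (x (n - 1)) = head E (x n)" if "n < -1" for n
    using t[of "n - 1"] that by simp
  then show ?thesis using a by (auto simp: left_inf_paths_def left_shift_def)
qed

lemma map_left_inf_in_paths_to:
  assumes "x \<in> left_inf_paths E" "n < 0"
  shows "map x [n..-1] \<in> paths_to E (head E (x n))"
proof -
  have "tail E (x (n + int i)) = head E (x (n + int (Suc i)))" if "Suc i < nat (- n)" for i
  proof -
    have "n + int i < -1" using that by linarith
    then have "tail E (x (n + int i)) = head E (x (n + int i + 1))"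
      using assms by (auto simp: left_inf_paths_def)
    then show ?thesis by (simp add: algebra_simps)
  qed
  moreover have "set (map x [n..-1]) \<subseteq> arcs E"
    using assms by (auto simp: left_inf_paths_def PiE_def Pi_def)
  moreover have "hd (map x [n..-1]) = x n"
    using assms by (simp add: upto_rec1)
  ultimately show ?thesis
    using assms unfolding paths_to_def by (auto simp: nth_upto)
qed

lemma map_right_inf_in_paths_to:
  assumes "x \<in> bi_inf_paths E"
  shows "map (\<lambda>k. x (n + int k)) [0..<k] \<in> paths_to E (head E (x n))"
proof -
  have "tail E (x (n + int i)) = head E (x (n + int (Suc i)))" for i
    using assms unfolding bi_inf_paths_def by (smt (verit) mem_Collect_eq of_nat_Suc)
  moreover have "hd (map (\<lambda>k. x (n + int k)) [0..<k]) = x n" if "k > 0"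
    using that by (simp add: hd_map)
  ultimately show ?thesis
    using assms by (auto simp: bi_inf_paths_def paths_to_def)
qed

lemma map_left_shift:
  assumes "n < 0"
  shows "map z [n - 1..-1] = map (left_shift z) [n..-1] @ [z (-1)]"
proof (rule nth_equalityI)
  show "length (map z [n - 1..-1]) = length (map (left_shift z) [n..-1] @ [z (-1)])"
    using assms by simp
  show "map z [n - 1..-1] ! i = (map (left_shift z) [n..-1] @ [z (-1)]) ! i"
    if i: "i < length (map z [n - 1..-1])" for i
  proof (cases "i < nat (- n)")
    case True
    then show ?thesis
      using assms by (auto simp: nth_append nth_upto left_shift_def algebra_simps)
  next
    case False
    with i assms have "int i = - n" by auto
    then show ?thesis using False assms by (simp add: nth_append nth_upto)
  qed
qed

lemma continuous_map_left_shift: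
  assumes "wf_digraph E"
  shows "continuous_map (left_inf_topology E) (left_inf_topology E) left_shift"
proof -
  let ?Z = "\<lambda>p. {x \<in> left_inf_paths E. map x [- int (length p)..-1] = p}"
  let ?P = "\<Union>v\<in>verts E. paths_to E v"
  note ts = topspace_left_inf_topology[OF assms]
  have "openin (left_inf_topology E) (left_shift -` ?Z p \<inter> left_inf_paths E)"
    if p: "p \<in> ?P" for p
  proof (cases "p = []")
    case True
    then have "left_shift -` ?Z p \<inter> left_inf_paths E = topspace (left_inf_topology E)"
      using left_shift_in by (auto simp: ts)
    then show ?thesis by simp
  next
    case False
    have eq: "map x [- int (length p) - 1..-1] = map (left_shift x) [- int (length p)..-1] @ [x (-1)]"
      for x :: "int \<Rightarrow> 'b"
      using map_left_shift[of "- int (length p)"] False by simp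
    have "\<exists>T. openin (left_inf_topology E) T \<and> x \<in> T \<and> T \<subseteq> left_shift -` ?Z p \<inter> left_inf_paths E"
      if "x \<in> left_shift -` ?Z p \<inter> left_inf_paths E" for x
    proof (intro exI[of _ "?Z (p @ [x (-1)])"] conjI)
      have len: "- int (length (p @ [x (-1)])) = - int (length p) - 1" by simp
      have x: "x \<in> left_inf_paths E" "map (left_shift x) [- int (length p)..-1] = p"
        using that by auto
      then have e: "map x [- int (length p) - 1..-1] = p @ [x (-1)]" by (simp only: eq)
      then show "x \<in> ?Z (p @ [x (-1)])" using x(1) len by (simp only: mem_Collect_eq)
      have "x (- int (length p) - 1) \<in> arcs E"
        using x(1) by (auto simp: left_inf_paths_def PiE_def Pi_def)
      then have v: "head E (x (- int (length p) - 1)) \<in> verts E"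
        by (rule wf_digraph.head_in_verts[OF assms])
      have "p @ [x (-1)] \<in> paths_to E (head E (x (- int (length p) - 1)))"
        using map_left_inf_in_paths_to[OF x(1), of "- int (length p) - 1"] e by simp
      with v show "openin (left_inf_topology E) (?Z (p @ [x (-1)]))"
        unfolding left_inf_topology_def by (intro topology_generated_by_Basis) blast
      show "?Z (p @ [x (-1)]) \<subseteq> left_shift -` ?Z p \<inter> left_inf_paths E"
      proof
        fix y assume "y \<in> ?Z (p @ [x (-1)])"
        then have y: "y \<in> left_inf_paths E" "map y [- int (length p) - 1..-1] = p @ [x (-1)]"
          unfolding len mem_Collect_eq by auto
        then have "map (left_shift y) [- int (length p)..-1] = p"
          using eq[of y] by (metis append1_eq_conv)
        with y(1) show "y \<in> left_shift -` ?Z p \<inter> left_inf_paths E"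
          using left_shift_in by simp
      qed
    qed
    then show ?thesis by (subst openin_subopen) blast
  qed
  moreover have "left_shift ` topspace (left_inf_topology E) \<subseteq> topspace (left_inf_topology E)"
    using left_shift_in by (auto simp: ts)
  moreover have "left_inf_topology E = topology_generated_by {?Z p |p. p \<in> ?P}"
    by (simp only: left_inf_topology_def)
  moreover have "continuous_map (left_inf_topology E) (topology_generated_by \<S>) left_shift"
    if "\<And>U. U \<in> \<S> \<Longrightarrow> openin (left_inf_topology E) (left_shift -` U \<inter> left_inf_paths E)"
      "left_shift ` topspace (left_inf_topology E) \<subseteq> \<Union>\<S>" for \<S> :: "(int \<Rightarrow> 'b) set set"
    using that by (intro continuous_on_generated_topo) (simp_all add: ts)
  ultimately show ?thesis
    by (smt (verit) mem_Collect_eq topology_generated_by_topspace)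
qed

lemma topspace_inverse_limit:
  "topspace (inverse_limit X f) = {\<xi> \<in> {1..} \<rightarrow>\<^sub>E topspace X. \<forall>n\<ge>1. f (\<xi> (n + 1)) = \<xi> n}"
  by (auto simp: inverse_limit_def)

lemma homeomorphic_map_inverse_limit_shift:
  assumes "continuous_map X X f"
  shows "homeomorphic_map (inverse_limit X f) (inverse_limit X f) (inverse_limit_shift f)"
proof -
  let ?L = "inverse_limit X f"
  let ?g = "\<lambda>\<xi>. (\<lambda>n\<in>{1..}. \<xi> (n + 1))"
  have mem: "f (\<xi> (Suc n)) = \<xi> n" "\<xi> n \<in> topspace X" if "\<xi> \<in> topspace ?L" "n \<ge> 1" for \<xi> n
    using that by (auto simp: topspace_inverse_limit)
  have ext: "\<xi> n = undefined" if "\<xi> \<in> topspace ?L" "n < 1" for \<xi> n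
    using that by (auto simp: topspace_inverse_limit PiE_def extensional_def)
  have proj: "continuous_map ?L X (\<lambda>\<xi>. \<xi> n)" if "n \<ge> 1" for n
    unfolding inverse_limit_def
    by (rule continuous_map_from_subtopology)
      (rule continuous_map_product_projection, use that in simp)
  have into: "continuous_map ?L ?L h"
    if "\<And>n. n \<ge> 1 \<Longrightarrow> continuous_map ?L X (\<lambda>\<xi>. h \<xi> n)" "\<And>\<xi>. h \<xi> \<in> extensional {1..}"
      "\<And>\<xi> n. \<lbrakk>\<xi> \<in> topspace ?L; n \<ge> 1\<rbrakk> \<Longrightarrow> f (h \<xi> (n + 1)) = h \<xi> n" for h
  proof -
    have "continuous_map ?L (product_topology (\<lambda>_. X) {1..}) h"
      using that(1,2) by (auto simp: continuous_map_componentwise)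
    moreover have "h ` topspace ?L \<subseteq> {\<xi>. \<forall>n\<ge>1. f (\<xi> (n + 1)) = \<xi> n}"
      using that(3) by auto
    ultimately have "continuous_map ?L
        (subtopology (product_topology (\<lambda>_. X) {1..}) {\<xi>. \<forall>n\<ge>1. f (\<xi> (n + 1)) = \<xi> n}) h"
      unfolding continuous_map_in_subtopology by (auto simp: image_subset_iff)
    then show ?thesis by (simp only: inverse_limit_def)
  qed
  have s: "continuous_map ?L ?L (inverse_limit_shift f)"
  proof (rule into)
    fix n :: nat assume n: "n \<ge> 1"
    show "continuous_map ?L X (\<lambda>\<xi>. inverse_limit_shift f \<xi> n)"
    proof (cases "n = 1")
      case True
      have "continuous_map ?L X (f \<circ> (\<lambda>\<xi>. \<xi> 1))"
        by (rule continuous_map_compose[OF proj assms]) simp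
      then show ?thesis using True by (simp add: inverse_limit_shift_def o_def)
    next
      case False
      then show ?thesis using n proj[of "n - 1"] by (simp add: inverse_limit_shift_def)
    qed
  next
    fix \<xi> and n :: nat assume "\<xi> \<in> topspace ?L" "n \<ge> 1"
    then show "f (inverse_limit_shift f \<xi> (n + 1)) = inverse_limit_shift f \<xi> n"
      using mem(1)[of \<xi> "n - 1"] by (auto simp: inverse_limit_shift_def)
  qed (simp add: inverse_limit_shift_def)
  have g: "continuous_map ?L ?L ?g"
  proof (rule into)
    fix n :: nat assume "n \<ge> 1"
    then show "continuous_map ?L X (\<lambda>\<xi>. ?g \<xi> n)" using proj[of "n + 1"] by simp
  qed (use mem in auto)
  have "homeomorphic_maps ?L ?L (inverse_limit_shift f) ?g"
    unfolding homeomorphic_maps_def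
  proof (intro conjI ballI s g)
    fix \<xi> assume x: "\<xi> \<in> topspace ?L"
    show "?g (inverse_limit_shift f \<xi>) = \<xi>"
      using ext[OF x] by (auto simp: inverse_limit_shift_def restrict_def fun_eq_iff not_less_eq_eq)
    show "inverse_limit_shift f (?g \<xi>) = \<xi>"
      using ext[OF x] mem(1)[OF x, of 1]
      by (auto simp: inverse_limit_shift_def restrict_def fun_eq_iff not_less_eq_eq numeral_2_eq_2)
  qed
  then show ?thesis by (auto simp: homeomorphic_map_maps)
qed

lemma paths_to_head: "\<lbrakk>p \<in> paths_to E v; p \<noteq> []\<rbrakk> \<Longrightarrow> head E (hd p) = v"
  by (simp add: paths_to_def)

context self_similar_groupoid_action
begin

definition ginv where
  "ginv g = (SOME h. h \<in> arrows G \<and> gdom G h = gcod G g \<and> gcod G h = gdom G g \<and>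
      gcomp G h g = gunit G (gdom G g) \<and> gcomp G g h = gunit G (gcod G g))"

lemma ginv:
  assumes "g \<in> arrows G"
  shows "ginv g \<in> arrows G" "gdom G (ginv g) = gcod G g" "gcod G (ginv g) = gdom G g"
    "gcomp G (ginv g) g = gunit G (gdom G g)"
  using someI_ex[OF ginverse_ex[OF assms, unfolded Bex_def]] unfolding ginv_def by auto

lemma edge_restriction_eq:
  assumes "is_edge_restriction E G act g e h"
  shows "edge_restriction E G act g e = h"
  unfolding edge_restriction_def
proof (rule the_equality[of "is_edge_restriction E G act g e", OF assms])
  fix k assume "is_edge_restriction E G act g e k"
  with assms have "gdom G k = gdom G h" "gcod G k = gcod G h" "k \<in> arrows G" "h \<in> arrows G"
    "\<forall>p\<in>paths_to E (gdom G h). act k p = act h p"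
    by (auto simp: is_edge_restriction_def)
  then show "k = h"
    using inj_onD[OF act_inj, of k h] by (simp add: restrict_def fun_eq_iff)
qed

lemma act_in:
  assumes "g \<in> arrows G" "p \<in> paths_to E (gdom G g)"
  shows "act g p \<in> paths_to E (gcod G g)" "length (act g p) = length p"
  using act_piso[OF assms(1)] assms(2) by (auto simp: partial_iso_def bij_betw_def)

lemma act_snoc:
  assumes "g \<in> arrows G" "p @ [e] \<in> paths_to E (gdom G g)"
  shows "\<exists>e'. act g (p @ [e]) = act g p @ [e']"
  using act_piso[OF assms(1)] assms(2) unfolding partial_iso_def by blast

lemma act_ginv:
  assumes "g \<in> arrows G" "p \<in> paths_to E (gdom G g)"
  shows "act (ginv g) (act g p) = p"
proof -
  have "act (ginv g) (act g p) = act (gcomp G (ginv g) g) p"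
    using act_gcomp[of "ginv g" g p] ginv[OF assms(1)] assms by simp
  then show ?thesis using ginv(4) assms by (simp add: act_gunit gdom_in)
qed

lemma gcod_eq_head:
  assumes "g \<in> arrows G" "p \<in> paths_to E (gdom G g)" "p \<noteq> []"
  shows "gcod G g = head E (hd (act g p))"
  using act_in[OF assms(1,2)] paths_to_head assms(3) by (metis length_0_conv)

lemma act_right_inf_prefix:
  assumes g: "g \<in> arrows G" and z: "\<And>k. map z [0..<k] \<in> paths_to E (gdom G g)"
  shows "act g (map z [0..<k]) = map (act_right_inf act g z) [0..<k]"
proof (induction k)
  case 0
  then show ?case using act_in(2)[OF g z[of 0]] by simp
next
  case (Suc k)
  have "map z [0..<k] @ [z k] \<in> paths_to E (gdom G g)" using z[of "Suc k"] by simp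
  from act_snoc[OF g this] obtain e' where
    e': "act g (map z [0..<Suc k]) = act g (map z [0..<k]) @ [e']" by auto
  then have "act_right_inf act g z k = e'" by (simp add: act_right_inf_def)
  with e' Suc show ?case by simp
qed

lemma act_right_inf_eqI:
  assumes g: "g \<in> arrows G" and "\<And>k. act g (map z [0..<k]) = map w [0..<k]"
  shows "act_right_inf act g z = w"
  unfolding act_right_inf_def using assms(2) by (auto simp del: upt_Suc intro!: ext) simp

lemma finite_gcomp_range:
  assumes "finite (g ` A)" "finite (h ` A)"
  shows "finite ((\<lambda>n. gcomp G (h n) (g n)) ` A)"
proof -
  have "(\<lambda>n. gcomp G (h n) (g n)) ` A \<subseteq> (\<lambda>(a, b). gcomp G a b) ` (h ` A \<times> g ` A)" by auto
  with assms show ?thesis by (meson finite_SigmaI finite_imageI finite_subset)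
qed

lemma equiv_ae_left:
  assumes "fin_digraph E"
  shows "equiv (left_inf_paths E) (ae_left E G act)"
proof (rule equivI)
  interpret fin_digraph E by fact
  show "ae_left E G act \<subseteq> left_inf_paths E \<times> left_inf_paths E"
    by (auto simp: ae_left_def)
  show "refl_on (left_inf_paths E) (ae_left E G act)"
  proof (rule refl_onI)
    fix x assume x: "x \<in> left_inf_paths E"
    have v: "head E (x n) \<in> verts E" if "n < 0" for n
      using x that by (auto simp: left_inf_paths_def PiE_def Pi_def)
    let ?g = "\<lambda>n. gunit G (head E (x n))"
    have "?g ` {..<0} \<subseteq> gunit G ` verts E" using v by auto
    then have "finite (?g ` {..<0})" by (meson finite_imageI finite_subset finite_verts)
    moreover have "\<forall>n<0. gdom G (?g n) = head E (x n) \<and> act (?g n) (map x [n..-1]) = map x [n..-1]"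
      using v map_left_inf_in_paths_to[OF x] by (auto simp: gdom_gunit act_gunit)
    moreover have "?g ` {..<0} \<subseteq> arrows G" using v by (auto simp: gunit_in)
    ultimately show "(x, x) \<in> ae_left E G act"
      using x by (auto simp: ae_left_def intro!: exI[of _ ?g])
  qed
  have dom: "gcod G (g n) = head E (y n)"
    if "n < 0" "g n \<in> arrows G" "gdom G (g n) = head E (x n)" "x \<in> left_inf_paths E"
      "act (g n) (map x [n..-1]) = map y [n..-1]" for g :: "int \<Rightarrow> 'g" and x y n
  proof -
    have "map x [n..-1] \<noteq> []" "hd (map y [n..-1]) = y n" using that by (auto simp: upto_rec1)
    then show ?thesis
      using gcod_eq_head[of "g n" "map x [n..-1]"] map_left_inf_in_paths_to[of x E n] that by simp
  qed
  show "sym (ae_left E G act)"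
  proof (rule symI)
    fix x y assume "(x, y) \<in> ae_left E G act"
    then obtain g where x: "x \<in> left_inf_paths E" and y: "y \<in> left_inf_paths E"
      and g: "g ` {..<0} \<subseteq> arrows G" and fin: "finite (g ` {..<0})"
      and eq: "\<And>n::int. n < 0 \<Longrightarrow> gdom G (g n) = head E (x n)"
        "\<And>n::int. n < 0 \<Longrightarrow> act (g n) (map x [n..-1]) = map y [n..-1]"
      unfolding ae_left_def by auto
    let ?h = "\<lambda>n. ginv (g n)"
    have gi: "g n \<in> arrows G" if "n < 0" for n using g that by auto
    have "finite (?h ` {..<0})" using finite_imageI[OF fin, of ginv] by (simp add: image_image)
    moreover have "?h ` {..<0} \<subseteq> arrows G" using ginv gi by auto
    moreover have "gdom G (?h n) = head E (y n)" if "n < 0" for n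
      using dom[of n g x y] ginv gi eq that x by simp
    moreover have "act (?h n) (map y [n..-1]) = map x [n..-1]" if "n < 0" for n
      using act_ginv[of "g n" "map x [n..-1]"] gi eq that map_left_inf_in_paths_to[OF x that] by simp
    ultimately show "(y, x) \<in> ae_left E G act"
      using x y by (auto simp: ae_left_def intro!: exI[of _ ?h])
  qed
  show "trans (ae_left E G act)"
  proof (rule transI)
    fix x y z assume "(x, y) \<in> ae_left E G act" "(y, z) \<in> ae_left E G act"
    then obtain g h where x: "x \<in> left_inf_paths E" and y: "y \<in> left_inf_paths E"
      and z: "z \<in> left_inf_paths E"
      and g: "g ` {..<0} \<subseteq> arrows G" and fin: "finite (g ` {..<0})"
      and eq: "\<And>n::int. n < 0 \<Longrightarrow> gdom G (g n) = head E (x n)"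
        "\<And>n::int. n < 0 \<Longrightarrow> act (g n) (map x [n..-1]) = map y [n..-1]"
      and h: "h ` {..<0} \<subseteq> arrows G" and finh: "finite (h ` {..<0})"
      and eqh: "\<And>n::int. n < 0 \<Longrightarrow> gdom G (h n) = head E (y n)"
        "\<And>n::int. n < 0 \<Longrightarrow> act (h n) (map y [n..-1]) = map z [n..-1]"
      unfolding ae_left_def by auto
    have gi: "g n \<in> arrows G" "h n \<in> arrows G" if "n < 0" for n using g h that by auto
    have comp: "gdom G (h n) = gcod G (g n)" if "n < 0" for n
      using dom[of n g x y] gi eq eqh that x by simp
    let ?k = "\<lambda>n. gcomp G (h n) (g n)"
    have "finite (?k ` {..<0})" using finite_gcomp_range fin finh .
    moreover have "?k ` {..<0} \<subseteq> arrows G" using gcomp_in gi comp by auto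
    moreover have "gdom G (?k n) = head E (x n)" if "n < 0" for n
      using gdom_gcomp gi comp eq that by simp
    moreover have "act (?k n) (map x [n..-1]) = map z [n..-1]" if "n < 0" for n
      using act_gcomp[of "h n" "g n" "map x [n..-1]"] gi comp eq eqh that
        map_left_inf_in_paths_to[OF x that] by simp
    ultimately show "(x, z) \<in> ae_left E G act"
      using x z by (auto simp: ae_left_def intro!: exI[of _ ?k])
  qed
qed

lemma equiv_ae_bi:
  assumes "fin_digraph E"
  shows "equiv (bi_inf_paths E) (ae_bi E G act)"
proof (rule equivI)
  interpret fin_digraph E by fact
  show "ae_bi E G act \<subseteq> bi_inf_paths E \<times> bi_inf_paths E"
    by (auto simp: ae_bi_def)
  have prefix: "act (g n) (map (\<lambda>k. x (n + int k)) [0..<k]) = map (\<lambda>k. y (n + int k)) [0..<k]"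
    if "g n \<in> arrows G" "gdom G (g n) = head E (x n)" "x \<in> bi_inf_paths E"
      "act_right_inf act (g n) (\<lambda>k. x (n + int k)) = (\<lambda>k. y (n + int k))"
    for g :: "int \<Rightarrow> 'g" and x y n k
    using act_right_inf_prefix[of "g n" "\<lambda>k. x (n + int k)" k] map_right_inf_in_paths_to[of x E n]
      that by simp
  have dom: "gcod G (g n) = head E (y n)"
    if "g n \<in> arrows G" "gdom G (g n) = head E (x n)" "x \<in> bi_inf_paths E"
      "act_right_inf act (g n) (\<lambda>k. x (n + int k)) = (\<lambda>k. y (n + int k))"
    for g :: "int \<Rightarrow> 'g" and x y n
    using gcod_eq_head[of "g n" "map (\<lambda>k. x (n + int k)) [0..<1]"] prefix[of g n x y 1]
      map_right_inf_in_paths_to[of x E n 1] that by simp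
  show "refl_on (bi_inf_paths E) (ae_bi E G act)"
  proof (rule refl_onI)
    fix x assume x: "x \<in> bi_inf_paths E"
    have v: "head E (x n) \<in> verts E" for n
      using x by (intro head_in_verts) (auto simp: bi_inf_paths_def)
    let ?g = "\<lambda>n. gunit G (head E (x n))"
    have "range ?g \<subseteq> gunit G ` verts E" using v by auto
    then have "finite (range ?g)" by (meson finite_imageI finite_subset finite_verts)
    moreover have "act_right_inf act (?g n) (\<lambda>k. x (n + int k)) = (\<lambda>k. x (n + int k))" for n
      using v map_right_inf_in_paths_to[OF x]
      by (intro act_right_inf_eqI) (auto simp: gunit_in act_gunit)
    moreover have "range ?g \<subseteq> arrows G" using v by (auto simp: gunit_in)
    ultimately show "(x, x) \<in> ae_bi E G act"
      using x v by (auto simp: ae_bi_def gdom_gunit intro!: exI[of _ ?g])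
  qed
  show "sym (ae_bi E G act)"
  proof (rule symI)
    fix x y assume "(x, y) \<in> ae_bi E G act"
    then obtain g where x: "x \<in> bi_inf_paths E" and y: "y \<in> bi_inf_paths E"
      and g: "range g \<subseteq> arrows G" and fin: "finite (range g)"
      and eq: "\<And>n::int. gdom G (g n) = head E (x n)"
        "\<And>n::int. act_right_inf act (g n) (\<lambda>k. x (n + int k)) = (\<lambda>k. y (n + int k))"
      unfolding ae_bi_def by auto
    let ?h = "\<lambda>n. ginv (g n)"
    have gi: "g n \<in> arrows G" for n using g by auto
    have "finite (range ?h)" using finite_imageI[OF fin, of ginv] by (simp add: image_image)
    moreover have "range ?h \<subseteq> arrows G" using ginv gi by auto
    moreover have "gdom G (?h n) = head E (y n)" for n
      using dom[of g n x y] ginv gi eq x by simp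
    moreover have "act_right_inf act (?h n) (\<lambda>k. y (n + int k)) = (\<lambda>k. x (n + int k))" for n
    proof (rule act_right_inf_eqI)
      show "ginv (g n) \<in> arrows G" using ginv gi by blast
      show "act (ginv (g n)) (map (\<lambda>k. y (n + int k)) [0..<k]) = map (\<lambda>k. x (n + int k)) [0..<k]"
        for k
        using act_ginv[OF gi[of n], of "map (\<lambda>k. x (n + int k)) [0..<k]"] prefix[of g n x y, OF gi eq(1) x eq(2)]
          map_right_inf_in_paths_to[OF x] eq(1) by simp
    qed
    ultimately show "(y, x) \<in> ae_bi E G act"
      using x y by (auto simp: ae_bi_def intro!: exI[of _ ?h])
  qed
  show "trans (ae_bi E G act)"
  proof (rule transI)
    fix x y z assume "(x, y) \<in> ae_bi E G act" "(y, z) \<in> ae_bi E G act"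
    then obtain g h where x: "x \<in> bi_inf_paths E" and y: "y \<in> bi_inf_paths E"
      and z: "z \<in> bi_inf_paths E"
      and g: "range g \<subseteq> arrows G" and fin: "finite (range g)"
      and eq: "\<And>n::int. gdom G (g n) = head E (x n)"
        "\<And>n::int. act_right_inf act (g n) (\<lambda>k. x (n + int k)) = (\<lambda>k. y (n + int k))"
      and h: "range h \<subseteq> arrows G" and finh: "finite (range h)"
      and eqh: "\<And>n::int. gdom G (h n) = head E (y n)"
        "\<And>n::int. act_right_inf act (h n) (\<lambda>k. y (n + int k)) = (\<lambda>k. z (n + int k))"
      unfolding ae_bi_def by auto
    have gi: "g n \<in> arrows G" "h n \<in> arrows G" for n using g h by auto
    have comp: "gdom G (h n) = gcod G (g n)" for n
      using dom[of g n x y] gi eq eqh x by simp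
    let ?k = "\<lambda>n. gcomp G (h n) (g n)"
    have "finite (range ?k)" using finite_gcomp_range fin finh .
    moreover have k: "range ?k \<subseteq> arrows G" using gcomp_in gi comp by auto
    moreover have "gdom G (?k n) = head E (x n)" for n
      using gdom_gcomp gi comp eq by simp
    moreover have "act_right_inf act (?k n) (\<lambda>k. x (n + int k)) = (\<lambda>k. z (n + int k))" for n
    proof (rule act_right_inf_eqI)
      show "?k n \<in> arrows G" using k by blast
      show "act (?k n) (map (\<lambda>k. x (n + int k)) [0..<k]) = map (\<lambda>k. z (n + int k)) [0..<k]" for k
        using act_gcomp[OF gi(2,1) comp, of "map (\<lambda>k. x (n + int k)) [0..<k]" n]
          prefix[of g n x y, OF gi(1) eq(1) x eq(2)] prefix[of h n y z, OF gi(2) eqh(1) y eqh(2)]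
          map_right_inf_in_paths_to[OF x] eq(1) by simp
    qed
    ultimately show "(x, z) \<in> ae_bi E G act"
      using x z by (auto simp: ae_bi_def intro!: exI[of _ ?k])
  qed
qed

lemma ae_left_shift:
  assumes "(x, y) \<in> ae_left E G act"
  shows "(left_shift x, left_shift y) \<in> ae_left E G act"
proof -
  from assms obtain g where x: "x \<in> left_inf_paths E" and y: "y \<in> left_inf_paths E"
    and g: "g ` {..<0} \<subseteq> arrows G" and fin: "finite (g ` {..<0})"
    and eq: "\<And>n::int. n < 0 \<Longrightarrow> gdom G (g n) = head E (x n)"
      "\<And>n::int. n < 0 \<Longrightarrow> act (g n) (map x [n..-1]) = map y [n..-1]"
    unfolding ae_left_def by auto
  let ?h = "\<lambda>n. g (n - 1)"
  note sh = map_left_shift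
  have "?h ` {..<0} \<subseteq> g ` {..<0}" by auto
  then have "finite (?h ` {..<0})" "?h ` {..<0} \<subseteq> arrows G"
    using fin g by (auto intro: finite_subset)
  moreover have "gdom G (?h n) = head E (left_shift x n)" if "n < 0" for n
    using eq that by (simp add: left_shift_def)
  moreover have "act (?h n) (map (left_shift x) [n..-1]) = map (left_shift y) [n..-1]"
    if "n < 0" for n
  proof -
    have gi: "g (n - 1) \<in> arrows G" using g that by auto
    have "map x [n - 1..-1] \<in> paths_to E (gdom G (g (n - 1)))"
      using map_left_inf_in_paths_to[OF x, of "n - 1"] eq that by simp
    with act_snoc[OF gi] eq(2)[of "n - 1"] sh[OF that] that show ?thesis
      by (smt (verit) append1_eq_conv)
  qed
  ultimately show ?thesis
    using left_shift_in[OF x] left_shift_in[OF y]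
    by (auto simp: ae_left_def intro!: exI[of _ ?h])
qed

lemma limit_shift_class:
  assumes "fin_digraph E" and "x \<in> left_inf_paths E"
  shows "limit_shift E G act (ae_left E G act `` {x}) = ae_left E G act `` {left_shift x}"
  unfolding limit_shift_def
proof (rule UN_equiv_class[OF equiv_ae_left[OF assms(1)] _ assms(2)])
  show "(\<lambda>x. ae_left E G act `` {left_shift x}) respects ae_left E G act"
    using equiv_class_eq[OF equiv_ae_left[OF assms(1)] ae_left_shift] by (auto intro: congruentI)
qed

lemma continuous_map_limit_shift:
  assumes "fin_digraph E"
  shows "continuous_map (limit_space E G act) (limit_space E G act) (limit_shift E G act)"
proof -
  interpret fin_digraph E by fact
  let ?q = "\<lambda>x. ae_left E G act `` {x}"
  have q: "quotient_map (left_inf_topology E) (limit_space E G act) ?q"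
    unfolding limit_space_def by (rule quotient_map_quotient_topology)
  have "continuous_map (left_inf_topology E) (left_inf_topology E) left_shift"
    by (rule continuous_map_left_shift[OF wf_digraph])
  then have "continuous_map (left_inf_topology E) (limit_space E G act) (?q \<circ> left_shift)"
    using quotient_imp_continuous_map[OF q] by (rule continuous_map_compose)
  then have "continuous_map (left_inf_topology E) (limit_space E G act) (limit_shift E G act \<circ> ?q)"
    by (rule continuous_map_eq)
      (simp add: topspace_left_inf_topology[OF wf_digraph] limit_shift_class[OF assms])
  then show ?thesis by (rule continuous_compose_quotient_map[OF q])
qed

lemma homeomorphic_map_limit_shift:
  assumes "fin_digraph E"
  shows "homeomorphic_map (inverse_limit (limit_space E G act) (limit_shift E G act))
    (inverse_limit (limit_space E G act) (limit_shift E G act))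
    (inverse_limit_shift (limit_shift E G act))"
  by (rule homeomorphic_map_inverse_limit_shift[OF continuous_map_limit_shift[OF assms]])

end

end

theory Submission
  imports Defs
begin

text \<open>
  Contraction yields a finite set \<open>N\<close> of groupoid elements into which every element eventually
  restricts, so that both equivalence relations can be tested with elements of \<open>N\<close> only.  Hence
  \<open>\<sim>\<^sub>a\<^sub>e\<close> is closed on the compact space \<open>E\<^sup>-\<^sup>\<infinity>\<close> and \<open>\<J>\<close> is Hausdorff.  Injectivity of \<open>\<theta>\<close> is a
  pigeonhole argument in \<open>N\<close>.  For surjectivity, the bi-infinite paths whose left part up to a given
  position lies in a prescribed class form a decreasing sequence of closed sets, nonempty because
  without sources left-infinite paths extend to the right; compactness of \<open>E\<^sup>\<int>\<close> gives a common
  point.  A continuous bijection from a compact to a Hausdorff space is a homeomorphism.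
\<close>

section \<open>Finite paths and the restriction of groupoid elements along them\<close>

lemma paths_to_Cons_iff:
  "e # p \<in> paths_to E v \<longleftrightarrow> e \<in> arcs E \<and> head E e = v \<and> p \<in> paths_to E (tail E e)"
proof
  assume *: "e # p \<in> paths_to E v"
  have c: "tail E ((e # p) ! i) = head E ((e # p) ! Suc i)" if "Suc i < length (e # p)" for i
    using * that by (auto simp: paths_to_def)
  have "tail E (p ! i) = head E (p ! Suc i)" if "Suc i < length p" for i
    using c[of "Suc i"] that by simp
  moreover have "p \<noteq> [] \<longrightarrow> head E (hd p) = tail E e"
    using c[of 0] by (auto simp: hd_conv_nth)
  ultimately show "e \<in> arcs E \<and> head E e = v \<and> p \<in> paths_to E (tail E e)"
    using * by (auto simp: paths_to_def)
next
  assume *: "e \<in> arcs E \<and> head E e = v \<and> p \<in> paths_to E (tail E e)"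
  have "tail E ((e # p) ! i) = head E ((e # p) ! Suc i)" if "Suc i < length (e # p)" for i
    using * that by (cases i) (auto simp: paths_to_def hd_conv_nth)
  with * show "e # p \<in> paths_to E v" by (auto simp: paths_to_def)
qed

lemma paths_to_appendD1: "p @ q \<in> paths_to E v \<Longrightarrow> p \<in> paths_to E v"
proof (induction p arbitrary: v)
  case Nil
  then show ?case by (simp add: paths_to_def)
qed (simp add: paths_to_Cons_iff)

context self_similar_groupoid_action
begin

lemma edge_restriction_is:
  assumes "g \<in> arrows G" "e \<in> arcs E" "head E e = gdom G g"
  shows "is_edge_restriction E G act g e (edge_restriction E G act g e)"
  using edge_restriction_ex[OF assms] edge_restriction_eq by auto

lemma path_restriction_append:
  "path_restriction E G act g (p @ q)
    = path_restriction E G act (path_restriction E G act g p) q"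
  by (simp add: path_restriction_def)

text \<open>Induction on \<open>p\<close>, replacing \<open>g\<close> by its restriction to the
  first edge \<open>e\<close>. The three facts are proved together because each step needs the
  restriction to be an arrow that can still act on the rest of the path. In the last fact,
  \<open>act g [e]\<close> is split off both from the whole path and from
  \<open>e # p\<close>.\<close>

lemma path_restriction:
  assumes "g \<in> arrows G" "p @ q \<in> paths_to E (gdom G g)"
  shows "path_restriction E G act g p \<in> arrows G"
    "q \<in> paths_to E (gdom G (path_restriction E G act g p))"
    "act g (p @ q) = act g p @ act (path_restriction E G act g p) q"
proof -
  have "path_restriction E G act g p \<in> arrows G \<and>
    q \<in> paths_to E (gdom G (path_restriction E G act g p)) \<and>
    act g (p @ q) = act g p @ act (path_restriction E G act g p) q"
    using assms
  proof (induction p arbitrary: g)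
    case Nil
    then show ?case using act_in(2)[of g "[]"] by (simp add: path_restriction_def paths_to_def)
  next
    case (Cons e p)
    let ?h = "edge_restriction E G act g e"
    have e: "e \<in> arcs E" "head E e = gdom G g" "p @ q \<in> paths_to E (tail E e)"
      using Cons.prems(2) by (simp_all add: paths_to_Cons_iff)
    then have h: "?h \<in> arrows G" "gdom G ?h = tail E e"
      "\<And>p. p \<in> paths_to E (tail E e) \<Longrightarrow> act g (e # p) = act g [e] @ act ?h p"
      using edge_restriction_is[OF Cons.prems(1) e(1,2)] by (auto simp: is_edge_restriction_def)
    have eq: "path_restriction E G act g (e # p) = path_restriction E G act ?h p"
      by (simp add: path_restriction_def)
    show ?case
      using Cons.IH[OF h(1)] e(3) h(2) h(3)[OF e(3)] h(3)[OF paths_to_appendD1[OF e(3)]]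
      by (simp add: eq)
  qed
  then show "path_restriction E G act g p \<in> arrows G"
    "q \<in> paths_to E (gdom G (path_restriction E G act g p))"
    "act g (p @ q) = act g p @ act (path_restriction E G act g p) q" by auto
qed

section \<open>A finite set of arrows absorbing all restrictions\<close>

text \<open>Along a long path, one edge followed by as many edges as the contraction level of the
  resulting arrow leads from \<open>F\<close> back into \<open>F\<close>. The restriction is then
  one of an element of \<open>F\<close> along a strictly shorter path, so strong induction leaves
  only paths of bounded length, and these are finite in number over finitely many edges.\<close>

lemma finite_restrictions:
  assumes E: "fin_digraph E" and F: "finite F" "F \<subseteq> arrows G"
    and n: "\<And>g p. \<lbrakk>g \<in> arrows G; p \<in> paths_to E (gdom G g); length p = n g\<rbrakk>
      \<Longrightarrow> path_restriction E G act g p \<in> F"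
  shows "finite {path_restriction E G act f p |f p. f \<in> F \<and> p \<in> paths_to E (gdom G f)}"
proof -
  interpret fin_digraph E by fact
  let ?R = "path_restriction E G act"
  \<comment> \<open>Bounds the contraction levels of all \<open>f\<close> restricted to a single
    edge; the extra 1 accounts for that edge. If the maximum ranges over an empty set its value is
    arbitrary, which is harmless: the bound is only applied to given \<open>f\<close> and
    \<open>e\<close>.\<close>
  let ?M = "Max ((\<lambda>(f, e). n (edge_restriction E G act f e)) ` (F \<times> arcs E)) + 1"
  let ?N = "(\<lambda>(f, p). ?R f p) ` (F \<times> {p. set p \<subseteq> arcs E \<and> length p \<le> ?M})"
  have M: "n (edge_restriction E G act f e) < ?M" if "f \<in> F" "e \<in> arcs E" for f e
    using F(1) finite_arcs that by (auto simp: less_Suc_eq_le intro!: Max_ge)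
  have "?R f p \<in> ?N" if "f \<in> F" "p \<in> paths_to E (gdom G f)" for f p
    using that
  proof (induction "length p" arbitrary: f p rule: less_induct)
    case less
    show ?case
    proof (cases "length p \<le> ?M")
      case True
      then show ?thesis using less.prems by (force simp: paths_to_def)
    next
      case False
      \<comment> \<open>A first edge is split off because the contraction level of an element of \<open>F\<close> may be \<open>0\<close>.\<close>
      then obtain e p' where p: "p = e # p'" by (cases p) auto
      let ?h = "edge_restriction E G act f e"
      have f: "f \<in> arrows G" using F less.prems by auto
      have e: "e \<in> arcs E" "head E e = gdom G f" "p' \<in> paths_to E (tail E e)"
        using less.prems p by (simp_all add: paths_to_Cons_iff)
      then have h: "?h \<in> arrows G" "gdom G ?h = tail E e"
        using edge_restriction_is[OF f e(1,2)] by (auto simp: is_edge_restriction_def)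
      let ?a = "take (n ?h) p'" and ?b = "drop (n ?h) p'"
      have ab: "?a @ ?b \<in> paths_to E (gdom G ?h)" using e(3) h(2) by simp
      have "length ?a = n ?h" using M[OF less.prems(1) e(1)] False p by simp
      then have "?R ?h ?a \<in> F" using n[OF h(1) paths_to_appendD1[OF ab]] by blast
      moreover have "?b \<in> paths_to E (gdom G (?R ?h ?a))" by (rule path_restriction(2)[OF h(1) ab])
      moreover have "length ?b < length p" by (simp add: p)
      ultimately have "?R (?R ?h ?a) ?b \<in> ?N" by (intro less.hyps)
      moreover have "?R f p = ?R (?R ?h ?a) ?b"
        unfolding path_restriction_append[symmetric] by (simp add: p path_restriction_def)
      ultimately show ?thesis by simp
    qed
  qed
  then have "{?R f p |f p. f \<in> F \<and> p \<in> paths_to E (gdom G f)} \<subseteq> ?N" by blast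
  moreover have "finite ?N"
    using F(1) finite_lists_length_le[OF finite_arcs] by (intro finite_imageI finite_SigmaI) auto
  ultimately show ?thesis by (rule finite_subset)
qed

text \<open>\<open>contracting\<close> controls the restrictions of \<open>g\<close> at one level
  only. Adding to \<open>F\<close> all restrictions of its elements keeps it finite and covers every
  later level too: beyond the level of \<open>g\<close>, a restriction of \<open>g\<close> is a
  restriction of an element of \<open>F\<close>. The result plays the part of a nucleus, without
  being claimed to be minimal.\<close>

lemma contracting_nucleus:
  assumes E: "fin_digraph E" and "contracting E G act"
  obtains N where "finite N" "N \<subseteq> arrows G"
    "\<And>g. g \<in> arrows G \<Longrightarrow> \<exists>k. \<forall>p\<in>paths_to E (gdom G g). k \<le> length p \<longrightarrow>
       path_restriction E G act g p \<in> N"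
proof -
  let ?R = "path_restriction E G act"
  let ?C = "\<lambda>F g n. {?R g p |p. p \<in> paths_to E (gdom G g) \<and> length p = n} \<subseteq> F"
  from assms(2) obtain F where F: "finite F" "F \<subseteq> arrows G"
    and "\<forall>g\<in>arrows G. \<exists>n. ?C F g n"
    unfolding contracting_def by blast
  then obtain n where n: "\<And>g. g \<in> arrows G \<Longrightarrow> ?C F g (n g)"
    unfolding bchoice_iff by blast
  let ?N = "{?R f p |f p. f \<in> F \<and> p \<in> paths_to E (gdom G f)}"
  show thesis
  proof
    show "finite ?N" by (rule finite_restrictions[OF E F, of n]) (use n in blast)
    show "?N \<subseteq> arrows G" using path_restriction(1)[where q = "[]"] F(2) by auto
    fix g assume g: "g \<in> arrows G"
    show "\<exists>k. \<forall>p\<in>paths_to E (gdom G g). k \<le> length p \<longrightarrow> ?R g p \<in> ?N"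
    proof (intro exI ballI impI)
      fix p assume p: "p \<in> paths_to E (gdom G g)" "n g \<le> length p"
      let ?a = "take (n g) p" and ?b = "drop (n g) p"
      have ab: "?a @ ?b \<in> paths_to E (gdom G g)" using p by simp
      have "?R g ?a \<in> F" using n[OF g] paths_to_appendD1[OF ab] p(2)
        by (simp add: subset_iff) (metis length_take min.absorb2)
      moreover have "?b \<in> paths_to E (gdom G (?R g ?a))" by (rule path_restriction(2)[OF g ab])
      moreover have "?R g p = ?R (?R g ?a) ?b" unfolding path_restriction_append[symmetric] by simp
      ultimately show "?R g p \<in> ?N" by blast
    qed
  qed
qed

text \<open>An arrow for the window from \<open>n\<close> to -1 is found by starting further left
  and restricting along the edges before \<open>n\<close>; far enough to the left, this restriction
  lies in \<open>N\<close>. The gain is that the windows become independent conditions, each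
  involving finitely many edges and a fixed finite set of arrows.\<close>

lemma ae_left_iff_nucleus:
  assumes N: "finite N" "N \<subseteq> arrows G"
    "\<And>g. g \<in> arrows G \<Longrightarrow> \<exists>k. \<forall>p\<in>paths_to E (gdom G g). k \<le> length p \<longrightarrow>
       path_restriction E G act g p \<in> N"
  shows "(x, y) \<in> ae_left E G act \<longleftrightarrow> x \<in> left_inf_paths E \<and> y \<in> left_inf_paths E \<and>
    (\<forall>n<0. \<exists>f\<in>N. gdom G f = head E (x n) \<and> act f (map x [n..-1]) = map y [n..-1])"
    (is "_ \<longleftrightarrow> _ \<and> _ \<and> ?A")
proof
  assume "(x, y) \<in> ae_left E G act"
  then obtain g where x: "x \<in> left_inf_paths E" and y: "y \<in> left_inf_paths E"
    and g: "g ` {..<0} \<subseteq> arrows G" and fin: "finite (g ` {..<0})"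
    and eq: "\<And>n::int. n < 0 \<Longrightarrow> gdom G (g n) = head E (x n)"
      "\<And>n::int. n < 0 \<Longrightarrow> act (g n) (map x [n..-1]) = map y [n..-1]"
    unfolding ae_left_def by auto
  obtain k where k: "\<And>g p. \<lbrakk>g \<in> arrows G; p \<in> paths_to E (gdom G g); k g \<le> length p\<rbrakk> \<Longrightarrow>
       path_restriction E G act g p \<in> N"
    using bchoice[of "arrows G" "\<lambda>g k. \<forall>p\<in>paths_to E (gdom G g). k \<le> length p \<longrightarrow>
       path_restriction E G act g p \<in> N"] N(3) by blast
  \<comment> \<open>Here the finiteness of the set of values of \<open>g\<close> enters: one length
    works for all of them.\<close>
  let ?K = "Max (k ` g ` {..<0})"
  have K: "k (g n) \<le> ?K" if "n < 0" for n using fin that by (intro Max_ge) auto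
  have ?A
  proof (intro allI impI)
    fix n :: int assume n: "n < 0"
    let ?m = "n - int ?K"
    let ?p = "map x [?m..n - 1]" and ?q = "map x [n..-1]"
    let ?f = "path_restriction E G act (g ?m) ?p"
    have m: "?m < 0" using n by simp
    have split: "map z [?m..-1] = map z [?m..n - 1] @ map z [n..-1]" for z :: "int \<Rightarrow> 'e"
      using upto_split1[of ?m n "-1"] n by simp
    have gm: "g ?m \<in> arrows G" using g m by auto
    have pq: "?p @ ?q \<in> paths_to E (gdom G (g ?m))"
      using map_left_inf_in_paths_to[OF x m] eq(1)[OF m] split[of x] by simp
    note p = paths_to_appendD1[OF pq]
    note r = path_restriction[OF gm pq]
    have "?f \<in> N" using k[OF gm p] K[OF m] by simp
    moreover have "gdom G ?f = head E (x n)"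
      using paths_to_head[OF r(2)] n by (simp add: upto_rec1)
    moreover have "act ?f ?q = map y [n..-1]"
      using r(3) eq(2)[OF m] act_in(2)[OF gm p] unfolding split by simp
    ultimately show "\<exists>f\<in>N. gdom G f = head E (x n) \<and> act f ?q = map y [n..-1]" by blast
  qed
  with x y show "x \<in> left_inf_paths E \<and> y \<in> left_inf_paths E \<and> ?A" by blast
next
  assume *: "x \<in> left_inf_paths E \<and> y \<in> left_inf_paths E \<and> ?A"
  \<comment> \<open>The restriction to negative \<open>n\<close> moves inside the existential so
    that choice yields a total function; its other values do not matter.\<close>
  then have "\<forall>n. \<exists>f. n < 0 \<longrightarrow> f \<in> N \<and> gdom G f = head E (x n) \<and>
      act f (map x [n..-1]) = map y [n..-1]" by blast
  then obtain g where g: "\<And>n. n < 0 \<Longrightarrow> g n \<in> N \<and> gdom G (g n) = head E (x n) \<and>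
      act (g n) (map x [n..-1]) = map y [n..-1]" unfolding choice_iff by blast
  then have "g ` {..<0} \<subseteq> N" by auto
  then have "g ` {..<0} \<subseteq> arrows G" "finite (g ` {..<0})"
    using N(1,2) finite_subset by blast+
  with * g show "(x, y) \<in> ae_left E G act"
    unfolding ae_left_def mem_Collect_eq case_prod_conv by (intro conjI exI[of _ g]) simp_all
qed

end

section \<open>Path spaces as closed subspaces of products of discrete spaces\<close>

lemma topology_generated_by_eqI:
  assumes "\<And>B. B \<in> \<B> \<Longrightarrow> openin X B"
    and "\<And>U x. \<lbrakk>openin X U; x \<in> U\<rbrakk> \<Longrightarrow> \<exists>B\<in>\<B>. x \<in> B \<and> B \<subseteq> U"
  shows "topology_generated_by \<B> = X"
  unfolding topology_eq
proof (intro allI iffI)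
  fix U assume "openin (topology_generated_by \<B>) U"
  then have "generate_topology_on \<B> U" by (rule openin_topology_generated_by)
  then show "openin X U"
    by (rule generate_topology_on_coarsest[rotated 2]) (use assms(1) in simp_all)
next
  fix U assume "openin X U"
  then show "openin (topology_generated_by \<B>) U"
    by (subst openin_subopen) (meson assms(2) topology_generated_by_Basis)
qed

text \<open>A basic open box constrains finitely many coordinates, and over a discrete space each of
  these can be fixed to a single value. Openness thus becomes a combinatorial condition that
  replaces all later handling of boxes.\<close>

lemma openin_subtopology_product_discrete:
  assumes "L \<subseteq> I \<rightarrow>\<^sub>E A"
  shows "openin (subtopology (product_topology (\<lambda>_. discrete_topology A) I) L) U \<longleftrightarrow>
    U \<subseteq> L \<and> (\<forall>x\<in>U. \<exists>K. finite K \<and> K \<subseteq> I \<and> (\<forall>y\<in>L. (\<forall>i\<in>K. y i = x i) \<longrightarrow> y \<in> U))"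
    (is "openin (subtopology ?P L) U \<longleftrightarrow> _")
proof
  assume "openin (subtopology ?P L) U"
  then obtain T where T: "openin ?P T" "U = T \<inter> L" by (auto simp: openin_subtopology)
  have "\<exists>K. finite K \<and> K \<subseteq> I \<and> (\<forall>y\<in>L. (\<forall>i\<in>K. y i = x i) \<longrightarrow> y \<in> U)" if x: "x \<in> U" for x
  proof -
    from T x have "x \<in> T" by blast
    with T(1) obtain V where V: "finite {i \<in> I. V i \<noteq> A}" "x \<in> Pi\<^sub>E I V" "Pi\<^sub>E I V \<subseteq> T"
      unfolding openin_product_topology_alt topspace_discrete_topology by meson
    have "y \<in> U" if "y \<in> L" "\<forall>i\<in>{i \<in> I. V i \<noteq> A}. y i = x i" for y
    proof -
      have "y i \<in> V i" if "i \<in> I" for i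
        using that \<open>y \<in> L\<close> assms V(2) \<open>\<forall>i\<in>{i \<in> I. V i \<noteq> A}. y i = x i\<close>
        by (cases "V i = A") (auto simp: PiE_def Pi_def)
      then have "y \<in> Pi\<^sub>E I V" using \<open>y \<in> L\<close> assms by (auto simp: PiE_def)
      then show ?thesis using V(3) T(2) \<open>y \<in> L\<close> by blast
    qed
    with V(1) show ?thesis by blast
  qed
  with T(2) show "U \<subseteq> L \<and> (\<forall>x\<in>U. \<exists>K. finite K \<and> K \<subseteq> I \<and>
      (\<forall>y\<in>L. (\<forall>i\<in>K. y i = x i) \<longrightarrow> y \<in> U))" by blast
next
  assume *: "U \<subseteq> L \<and> (\<forall>x\<in>U. \<exists>K. finite K \<and> K \<subseteq> I \<and>
    (\<forall>y\<in>L. (\<forall>i\<in>K. y i = x i) \<longrightarrow> y \<in> U))"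
  have "\<exists>T. openin (subtopology ?P L) T \<and> x \<in> T \<and> T \<subseteq> U" if x: "x \<in> U" for x
  proof -
    from * x obtain K where K: "finite K" "K \<subseteq> I"
      "\<And>y. \<lbrakk>y \<in> L; \<forall>i\<in>K. y i = x i\<rbrakk> \<Longrightarrow> y \<in> U" by meson
    have xL: "x \<in> L" "x \<in> I \<rightarrow>\<^sub>E A" using * x assms by auto
    let ?V = "\<lambda>i. if i \<in> K then {x i} else A"
    have "openin ?P (Pi\<^sub>E I ?V)"
      unfolding openin_product_topology_alt
    proof (intro ballI exI conjI)
      show "finite {i \<in> I. ?V i \<noteq> topspace (discrete_topology A)}"
        using K(1) by (rule rev_finite_subset) auto
    qed (use xL K in \<open>auto simp: PiE_def Pi_def\<close>)
    then have "openin (subtopology ?P L) (Pi\<^sub>E I ?V \<inter> L)" by (auto simp: openin_subtopology)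
    moreover have "x \<in> Pi\<^sub>E I ?V \<inter> L" using xL by (auto simp: PiE_def)
    moreover have "Pi\<^sub>E I ?V \<inter> L \<subseteq> U" using K by (force simp: PiE_def Pi_def)
    ultimately show ?thesis by blast
  qed
  then show "openin (subtopology ?P L) U" by (subst openin_subopen) blast
qed

lemma closedin_product_discrete:
  assumes "L \<subseteq> I \<rightarrow>\<^sub>E A"
    and "\<And>x. \<lbrakk>x \<in> I \<rightarrow>\<^sub>E A; x \<notin> L\<rbrakk> \<Longrightarrow>
      \<exists>K. finite K \<and> K \<subseteq> I \<and> (\<forall>y. (\<forall>i\<in>K. y i = x i) \<longrightarrow> y \<notin> L)"
  shows "closedin (product_topology (\<lambda>_. discrete_topology A) I) L"
proof -
  let ?P = "product_topology (\<lambda>_. discrete_topology A) I"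
  \<comment> \<open>The subspace is the whole product, taken only so that the criterion for openness
    applies; \<open>subtopology_topspace\<close> removes it again.\<close>
  have "openin (subtopology ?P (I \<rightarrow>\<^sub>E A)) ((I \<rightarrow>\<^sub>E A) - L)"
    unfolding openin_subtopology_product_discrete[OF subset_refl]
  proof (intro conjI ballI Diff_subset)
    fix x assume x: "x \<in> (I \<rightarrow>\<^sub>E A) - L"
    then obtain K where "finite K" "K \<subseteq> I" "\<forall>y. (\<forall>i\<in>K. y i = x i) \<longrightarrow> y \<notin> L"
      using assms(2)[of x] by blast
    then show "\<exists>K. finite K \<and> K \<subseteq> I \<and> (\<forall>y\<in>I \<rightarrow>\<^sub>E A. (\<forall>i\<in>K. y i = x i) \<longrightarrow> y \<in> (I \<rightarrow>\<^sub>E A) - L)"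
      by (intro exI[of _ K]) simp
  qed
  moreover have "topspace ?P = I \<rightarrow>\<^sub>E A" by simp
  ultimately show ?thesis
    using assms(1) subtopology_topspace[of ?P] by (simp add: closedin_def)
qed

text \<open>Tychonoff's theorem for finite discrete factors, passed on to a closed subspace.\<close>

lemma compact_space_subtopology_product_discrete:
  assumes "finite A" "closedin (product_topology (\<lambda>_. discrete_topology A) I) L"
  shows "compact_space (subtopology (product_topology (\<lambda>_. discrete_topology A) I) L)"
proof -
  have "compact_space (product_topology (\<lambda>_. discrete_topology A) I)"
    using assms(1) by (simp add: compact_space_product_topology compact_space_discrete_topology)
  then show ?thesis using assms(2) closedin_compact_space compact_space_subtopology by blast
qed

lemma Hausdorff_space_subtopology_product_discrete:
  "Hausdorff_space (subtopology (product_topology (\<lambda>_. discrete_topology A) I) L)"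
  by (intro Hausdorff_space_subtopology) (simp add: Hausdorff_space_product_topology)

lemma finite_int_subset_interval:
  assumes "finite (K :: int set)"
  obtains N where "N > 0" "K \<subseteq> {- int N..int N}"
proof
  define S where "S = (\<Sum>i\<in>K. nat \<bar>i\<bar>)"
  have "nat \<bar>i\<bar> \<le> S" if "i \<in> K" for i
    using member_le_sum[OF that, of "\<lambda>i. nat \<bar>i\<bar>"] assms by (simp add: S_def)
  \<comment> \<open>The sum of absolute values is a crude bound; the successor makes it positive
    even for empty \<open>K\<close>.\<close>
  then show "K \<subseteq> {- int (Suc S)..int (Suc S)}" by force
qed simp

lemma map_upto_eq_map_upt:
  "map x [n..n + int k - 1] = map (\<lambda>j. x (n + int j)) [0..<k]"
  by (rule nth_equalityI) (auto simp: nth_upto)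

text \<open>Cylinders fix finitely many coordinates, and conversely any finite set of coordinates
  lies in a window ending at -1. The product description is what gives access to compactness and
  separation.\<close>

lemma left_inf_topology_eq:
  assumes "wf_digraph E"
  shows "left_inf_topology E =
    subtopology (product_topology (\<lambda>_. discrete_topology (arcs E)) {..<0}) (left_inf_paths E)"
    (is "_ = ?X")
  unfolding left_inf_topology_def
proof (rule topology_generated_by_eqI)
  interpret wf_digraph E by fact
  have L: "left_inf_paths E \<subseteq> {..<0} \<rightarrow>\<^sub>E arcs E" by (auto simp: left_inf_paths_def)
  note op = openin_subtopology_product_discrete[OF L]
  show "openin ?X B" if "B \<in> {{x \<in> left_inf_paths E. map x [- int (length p)..-1] = p} |p.
      p \<in> (\<Union>v\<in>verts E. paths_to E v)}" for B
  proof -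
    from that obtain p where B: "B = {x \<in> left_inf_paths E. map x [- int (length p)..-1] = p}"
      by blast
    have "\<exists>K. finite K \<and> K \<subseteq> {..<0} \<and> (\<forall>y\<in>left_inf_paths E. (\<forall>i\<in>K. y i = x i) \<longrightarrow> y \<in> B)"
      if "x \<in> B" for x
    proof (intro exI conjI ballI impI)
      fix y assume "y \<in> left_inf_paths E" "\<forall>i\<in>{- int (length p)..-1}. y i = x i"
      moreover from this(2) have "map y [- int (length p)..-1] = map x [- int (length p)..-1]"
        by simp
      ultimately show "y \<in> B" using that unfolding B mem_Collect_eq by metis
    qed auto
    then show ?thesis unfolding op using B by blast
  qed
  show "\<exists>B\<in>{{x \<in> left_inf_paths E. map x [- int (length p)..-1] = p} |p.
      p \<in> (\<Union>v\<in>verts E. paths_to E v)}. x \<in> B \<and> B \<subseteq> U" if U: "openin ?X U" and x: "x \<in> U" for U x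
  proof -
    from U x obtain K where K: "finite K" "K \<subseteq> {..<0}" and xL: "x \<in> left_inf_paths E"
      "\<And>y. \<lbrakk>y \<in> left_inf_paths E; \<forall>i\<in>K. y i = x i\<rbrakk> \<Longrightarrow> y \<in> U" unfolding op by (meson subsetD)
    \<comment> \<open>Positivity of \<open>N\<close> makes the window from \<open>- int N\<close> to
      -1 nonempty, as \<open>map_left_inf_in_paths_to\<close> requires.\<close>
    obtain N where N: "N > 0" "K \<subseteq> {- int N..int N}" using finite_int_subset_interval[OF K(1)] .
    let ?p = "map x [- int N..-1]"
    let ?B = "{y \<in> left_inf_paths E. map y [- int (length ?p)..-1] = ?p}"
    have "head E (x (- int N)) \<in> verts E"
      using xL(1) N(1) by (intro head_in_verts) (auto simp: left_inf_paths_def)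
    moreover have "?p \<in> paths_to E (head E (x (- int N)))"
      using N(1) by (intro map_left_inf_in_paths_to xL) simp
    moreover have "?B \<subseteq> U"
      using N(2) K(2) by (auto intro!: xL(2)) force
    moreover have "x \<in> ?B" using xL(1) by simp
    ultimately show ?thesis by blast
  qed
qed

lemma bi_inf_topology_eq:
  assumes "wf_digraph E"
  shows "bi_inf_topology E =
    subtopology (product_topology (\<lambda>_. discrete_topology (arcs E)) UNIV) (bi_inf_paths E)"
    (is "_ = ?X")
  unfolding bi_inf_topology_def
proof (rule topology_generated_by_eqI)
  interpret wf_digraph E by fact
  have L: "bi_inf_paths E \<subseteq> UNIV \<rightarrow>\<^sub>E arcs E" by (auto simp: bi_inf_paths_def)
  note op = openin_subtopology_product_discrete[OF L]
  show "openin ?X B" if "B \<in> {{x \<in> bi_inf_paths E. map x [m..m + int (length p) - 1] = p} |m p.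
      p \<in> (\<Union>v\<in>verts E. paths_to E v)}" for B
  proof -
    from that obtain m p where
      B: "B = {x \<in> bi_inf_paths E. map x [m..m + int (length p) - 1] = p}" by blast
    have "\<exists>K. finite K \<and> K \<subseteq> UNIV \<and> (\<forall>y\<in>bi_inf_paths E. (\<forall>i\<in>K. y i = x i) \<longrightarrow> y \<in> B)"
      if "x \<in> B" for x
    proof (intro exI conjI ballI impI)
      fix y assume "y \<in> bi_inf_paths E" "\<forall>i\<in>{m..m + int (length p) - 1}. y i = x i"
      moreover from this(2) have "map y [m..m + int (length p) - 1] = map x [m..m + int (length p) - 1]"
        by simp
      ultimately show "y \<in> B" using that unfolding B mem_Collect_eq by metis
    qed auto
    then show ?thesis unfolding op using B by blast
  qed
  show "\<exists>B\<in>{{x \<in> bi_inf_paths E. map x [m..m + int (length p) - 1] = p} |m p.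
      p \<in> (\<Union>v\<in>verts E. paths_to E v)}. x \<in> B \<and> B \<subseteq> U" if U: "openin ?X U" and x: "x \<in> U" for U x
  proof -
    from U x obtain K where K: "finite K" and xL: "x \<in> bi_inf_paths E"
      "\<And>y. \<lbrakk>y \<in> bi_inf_paths E; \<forall>i\<in>K. y i = x i\<rbrakk> \<Longrightarrow> y \<in> U" unfolding op by (meson subsetD)
    obtain N where N: "K \<subseteq> {- int N..int N}" using finite_int_subset_interval[OF K] .
    \<comment> \<open>The window from -N to N has 2N + 1 edges; its right end is written so that
      \<open>map_upto_eq_map_upt\<close> matches.\<close>
    let ?p = "map x [- int N..- int N + int (2 * N + 1) - 1]"
    let ?B = "{y \<in> bi_inf_paths E. map y [- int N..- int N + int (length ?p) - 1] = ?p}"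
    have "head E (x (- int N)) \<in> verts E"
      using xL(1) by (intro head_in_verts) (auto simp: bi_inf_paths_def)
    moreover have "?p \<in> paths_to E (head E (x (- int N)))"
      unfolding map_upto_eq_map_upt by (rule map_right_inf_in_paths_to[OF xL(1)])
    moreover have "?B \<subseteq> U"
      using N by (auto intro!: xL(2))
    moreover have "x \<in> ?B" using xL(1) by simp
    ultimately show ?thesis by blast
  qed
qed

lemma closedin_left_inf_paths:
  "closedin (product_topology (\<lambda>_. discrete_topology (arcs E)) {..<0}) (left_inf_paths E)"
proof (rule closedin_product_discrete)
  fix x assume "x \<in> {..<0} \<rightarrow>\<^sub>E arcs E" "x \<notin> left_inf_paths E"
  then obtain n where "n < -1" "tail E (x n) \<noteq> head E (x (n + 1))"
    by (auto simp: left_inf_paths_def)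
  then show "\<exists>K. finite K \<and> K \<subseteq> {..<0} \<and> (\<forall>y. (\<forall>i\<in>K. y i = x i) \<longrightarrow> y \<notin> left_inf_paths E)"
    \<comment> \<open>A broken composability condition involves two neighbouring edges only.\<close>
    by (intro exI[of _ "{n, n + 1}"]) (auto simp: left_inf_paths_def)
qed (auto simp: left_inf_paths_def)

lemma closedin_bi_inf_paths:
  "closedin (product_topology (\<lambda>_. discrete_topology (arcs E)) UNIV) (bi_inf_paths E)"
proof (rule closedin_product_discrete)
  fix x assume "x \<in> UNIV \<rightarrow>\<^sub>E arcs E" "x \<notin> bi_inf_paths E"
  then obtain n where "tail E (x n) \<noteq> head E (x (n + 1))"
    by (auto simp: bi_inf_paths_def)
  then show "\<exists>K. finite K \<and> K \<subseteq> UNIV \<and> (\<forall>y. (\<forall>i\<in>K. y i = x i) \<longrightarrow> y \<notin> bi_inf_paths E)"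
    by (intro exI[of _ "{n, n + 1}"]) (auto simp: bi_inf_paths_def intro!: exI[of _ n])
qed (auto simp: bi_inf_paths_def)

lemma compact_Hausdorff_left_inf:
  assumes "fin_digraph E"
  shows "compact_space (left_inf_topology E)" "Hausdorff_space (left_inf_topology E)"
proof -
  interpret fin_digraph E by fact
  show "compact_space (left_inf_topology E)" "Hausdorff_space (left_inf_topology E)"
    unfolding left_inf_topology_eq[OF wf_digraph]
    using compact_space_subtopology_product_discrete[OF finite_arcs closedin_left_inf_paths]
      Hausdorff_space_subtopology_product_discrete by blast+
qed

lemma compact_bi_inf:
  assumes "fin_digraph E"
  shows "compact_space (bi_inf_topology E)"
proof -
  interpret fin_digraph E by fact
  show ?thesis
    unfolding bi_inf_topology_eq[OF wf_digraph]
    by (rule compact_space_subtopology_product_discrete[OF finite_arcs closedin_bi_inf_paths])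
qed

section \<open>Hausdorff quotients of compact spaces\<close>

text \<open>The quotient map is closed: the saturation of a closed set is a projection of a closed
  subset of the product, and projecting along a compact factor is a closed map. Compact Hausdorff
  spaces are normal, and being normal and Hausdorff passes to images under closed continuous
  maps.\<close>

lemma Hausdorff_space_quotient_topology:
  assumes X: "compact_space X" "Hausdorff_space X"
    and R: "equiv (topspace X) R" "closedin (prod_topology X X) R"
  shows "Hausdorff_space (quotient_topology X R)"
proof -
  let ?q = "\<lambda>x. R `` {x}"
  have q: "quotient_map X (quotient_topology X R) ?q" by (rule quotient_map_quotient_topology)
  have "closed_map X (quotient_topology X R) ?q"
    unfolding closed_map_def
  proof (intro allI impI)
    fix C assume C: "closedin X C"
    then have CX: "C \<subseteq> topspace X" by (rule closedin_subset)
    have "closedin (prod_topology X X) (R \<inter> C \<times> topspace X)"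
      using R(2) C by (intro closedin_Int) (auto simp: closedin_prod_Times_iff)
    then have "closedin X (snd ` (R \<inter> C \<times> topspace X))"
      using closed_map_snd[OF X(1)] by (auto simp: closed_map_def)
    \<comment> \<open>This is the saturation of \<open>C\<close>, the preimage by which
      \<open>quotient_map_closedin\<close> tests the image of \<open>C\<close>.\<close>
    moreover have "snd ` (R \<inter> C \<times> topspace X) = {x \<in> topspace X. ?q x \<in> ?q ` C}"
    proof -
      have "x \<in> snd ` (R \<inter> C \<times> topspace X) \<longleftrightarrow> x \<in> topspace X \<and> (\<exists>c\<in>C. (c, x) \<in> R)" for x
        by force
      moreover have "(c, x) \<in> R \<longleftrightarrow> ?q x = ?q c" if "c \<in> C" "x \<in> topspace X" for c x
        using eq_equiv_class_iff[OF R(1), of c x] that CX by auto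
      ultimately show ?thesis by (auto simp del: Image_singleton_iff)
    qed
    moreover have "?q ` C \<subseteq> topspace (quotient_topology X R)"
      using q CX by (auto simp: quotient_map_def)
    ultimately show "closedin (quotient_topology X R) (?q ` C)"
      using q by (simp add: quotient_map_closedin)
  qed
  then show ?thesis
    using normal_Hausdorff_space_closed_continuous_map_image[of X "quotient_topology X R" ?q]
      quotient_imp_continuous_map[OF q] quotient_imp_surjective_map[OF q] X
      compact_Hausdorff_or_regular_imp_normal_space[of X] by blast
qed

section \<open>Left parts of bi-infinite paths and extension to the right\<close>

lemma left_part_in:
  assumes "x \<in> bi_inf_paths E" shows "left_part x n \<in> left_inf_paths E"
proof -
  have "tail E (x (n + 1 + k)) = head E (x (n + 1 + (k + 1)))" for k
    using assms by (simp add: bi_inf_paths_def add.assoc)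
  then show ?thesis using assms by (auto simp: left_part_def left_inf_paths_def bi_inf_paths_def)
qed

lemma left_shift_left_part: "left_shift (left_part x n) = left_part x (n - 1)"
  by (auto simp: left_shift_def left_part_def algebra_simps restrict_def)

lemma left_part_bi_shift: "left_part (bi_shift x) n = left_part x (n - 1)"
  by (auto simp: left_part_def bi_shift_def algebra_simps)

lemma map_left_part:
  assumes "n < 0"
  shows "map (left_part x m) [n..-1] = map (\<lambda>k. x (m + 1 + n + int k)) [0..<nat (- n)]"
  using assms by (intro nth_equalityI) (auto simp: nth_upto left_part_def algebra_simps)

lemma continuous_map_left_part:
  assumes "wf_digraph E"
  shows "continuous_map (bi_inf_topology E) (left_inf_topology E) (\<lambda>x. left_part x n)"
  unfolding left_inf_topology_eq[OF assms] continuous_map_in_subtopology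
proof
  show "continuous_map (bi_inf_topology E)
      (product_topology (\<lambda>_. discrete_topology (arcs E)) {..<0}) (\<lambda>x. left_part x n)"
    unfolding continuous_map_componentwise
  proof (intro conjI ballI)
    fix k :: int assume "k \<in> {..<0}"
    then have "(\<lambda>x. left_part x n k) = (\<lambda>x :: int \<Rightarrow> 'b. x (n + 1 + k))"
      by (auto simp: left_part_def)
    then show "continuous_map (bi_inf_topology E) (discrete_topology (arcs E))
        (\<lambda>x. left_part x n k)"
      unfolding bi_inf_topology_eq[OF assms]
      by (simp only:) (rule continuous_map_from_subtopology,
        rule continuous_map_product_projection, rule UNIV_I)
  qed (auto simp: left_part_def)
  show "(\<lambda>x. left_part x n) \<in> topspace (bi_inf_topology E) \<rightarrow> left_inf_paths E"
    using left_part_in by (auto simp: topspace_bi_inf_topology[OF assms])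
qed

text \<open>Composability asks the next edge to have range equal to the source of the current one.
  Such an edge exists since there are no sources; a chosen successor map \<open>f\<close> is
  iterated on the last edge of \<open>z\<close>.\<close>

lemma ex_right_extension:
  assumes "wf_digraph E" "no_sources E" "z \<in> left_inf_paths E"
  obtains x where "x \<in> bi_inf_paths E" "left_part x n = z"
proof -
  interpret wf_digraph E by fact
  have "\<forall>e\<in>arcs E. \<exists>e'\<in>arcs E. head E e' = tail E e"
    using assms(2) by (auto simp: no_sources_def)
  then obtain f where f: "\<And>e. e \<in> arcs E \<Longrightarrow> f e \<in> arcs E \<and> head E (f e) = tail E e" by metis
  \<comment> \<open>The exponent \<open>i + 1\<close> makes index 0 the first new edge, so that the
    recursion \<open>step\<close> already holds at index -1.\<close>
  define u where "u i = (if i < 0 then z i else (f ^^ nat (i + 1)) (z (-1)))" for i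
  have z: "z i \<in> arcs E" if "i < 0" for i using assms(3) that by (auto simp: left_inf_paths_def)
  have u: "u i \<in> arcs E" for i
  proof -
    have "(f ^^ k) (z (-1)) \<in> arcs E" for k by (induction k) (use z f in auto)
    then show ?thesis using z by (simp add: u_def)
  qed
  have step: "u (i + 1) = f (u i)" if "i \<ge> -1" for i
    using that by (cases "i = -1") (auto simp: u_def nat_add_distrib)
  have t: "tail E (u i) = head E (u (i + 1))" for i
  proof (cases "i < -1")
    case True
    then show ?thesis using assms(3) by (auto simp: u_def left_inf_paths_def)
  next
    case False
    then show ?thesis using step[of i] f[OF u[of i]] by simp
  qed
  show thesis
  proof
    \<comment> \<open>Shifting by \<open>n + 1\<close> moves the last edge of \<open>z\<close> from
      index -1 to index \<open>n\<close>.\<close>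
    have "tail E (u (i - (n + 1))) = head E (u (i + 1 - (n + 1)))" for i
      using t[of "i - (n + 1)"] by (simp add: algebra_simps)
    then show "(\<lambda>i. u (i - (n + 1))) \<in> bi_inf_paths E" using u by (auto simp: bi_inf_paths_def)
    show "left_part (\<lambda>i. u (i - (n + 1))) n = z"
      using assms(3) by (auto simp: left_part_def u_def left_inf_paths_def restrict_def fun_eq_iff PiE_def extensional_def)
  qed
qed

section \<open>Bi-infinite equivalence compared with equivalence of all left parts\<close>

context self_similar_groupoid_action
begin

lemma act_take:
  assumes "g \<in> arrows G" "p \<in> paths_to E (gdom G g)"
  shows "act g (take n p) = take n (act g p)"
proof -
  have *: "take n p @ drop n p \<in> paths_to E (gdom G g)" using assms by simp
  have "length (act g p) = length p" "length (act g (take n p)) = min (length p) n"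
    using act_in(2)[OF assms] act_in(2)[OF assms(1) paths_to_appendD1[OF *]] by simp_all
  then show ?thesis
    using path_restriction(3)[OF assms(1) *] by (cases "n \<le> length p") simp_all
qed

lemma ae_bi_imp_ae_left:
  assumes "(x, y) \<in> ae_bi E G act"
  shows "(left_part x m, left_part y m) \<in> ae_left E G act"
proof -
  from assms obtain g where x: "x \<in> bi_inf_paths E" and y: "y \<in> bi_inf_paths E"
    and g: "range g \<subseteq> arrows G" and fin: "finite (range g)"
    and eq: "\<And>n::int. gdom G (g n) = head E (x n)"
      "\<And>n::int. act_right_inf act (g n) (\<lambda>k. x (n + int k)) = (\<lambda>k. y (n + int k))"
    unfolding ae_bi_def by auto
  \<comment> \<open>Index \<open>n\<close> of \<open>left_part x m\<close> is index
    \<open>m + 1 + n\<close> of \<open>x\<close>.\<close>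
  let ?h = "\<lambda>n. g (m + 1 + n)"
  have gi: "g n \<in> arrows G" for n using g by auto
  have "gdom G (?h n) = head E (left_part x m n)" if "n < 0" for n
    using that eq(1) by (simp add: left_part_def)
  moreover have "act (?h n) (map (left_part x m) [n..-1]) = map (left_part y m) [n..-1]"
    if "n < 0" for n
    unfolding map_left_part[OF that]
    using act_right_inf_prefix[OF gi[of "m + 1 + n"], of "\<lambda>k. x (m + 1 + n + int k)"]
      map_right_inf_in_paths_to[OF x, of "m + 1 + n"] eq by simp
  moreover have "?h ` {..<0} \<subseteq> range g" by auto
  then have "?h ` {..<0} \<subseteq> arrows G" "finite (?h ` {..<0})"
    using g fin finite_subset by blast+
  ultimately show ?thesis
    using left_part_in[OF x, of m] left_part_in[OF y, of m]
    unfolding ae_left_def mem_Collect_eq case_prod_conv by (intro conjI exI[of _ ?h]) simp_all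
qed

text \<open>
  The pigeonhole principle in the finite set \<open>N\<close> turns the elements found separately for each
  window \<open>x\<^sub>n\<dots>x\<^sub>m\<close> into one element acting correctly on the whole right tail from \<open>n\<close>.
\<close>

lemma ae_bi_iff_ae_left:
  assumes E: "fin_digraph E" and con: "contracting E G act"
    and x: "x \<in> bi_inf_paths E" and y: "y \<in> bi_inf_paths E"
  shows "(x, y) \<in> ae_bi E G act \<longleftrightarrow>
    (\<forall>m\<ge>m0. (left_part x m, left_part y m) \<in> ae_left E G act)"
proof
  assume L: "\<forall>m\<ge>m0. (left_part x m, left_part y m) \<in> ae_left E G act"
  obtain N where N: "finite N" "N \<subseteq> arrows G"
    "\<And>g. g \<in> arrows G \<Longrightarrow> \<exists>k. \<forall>p\<in>paths_to E (gdom G g). k \<le> length p \<longrightarrow>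
       path_restriction E G act g p \<in> N"
    using contracting_nucleus[OF E con] by blast
  let ?x = "\<lambda>n k. map (\<lambda>j. x (n + int j)) [0..<k]"
  let ?y = "\<lambda>n k. map (\<lambda>j. y (n + int j)) [0..<k]"
  \<comment> \<open>An arrow correct on a window is correct on its initial segments; this
    monotonicity is what the pigeonhole argument rests on.\<close>
  have mono: "act f (?x n j) = ?y n j"
    if "f \<in> N" "gdom G f = head E (x n)" "act f (?x n k) = ?y n k" "j \<le> k" for f n j k
  proof -
    have "?x n k \<in> paths_to E (gdom G f)" using map_right_inf_in_paths_to[OF x] that(2) by simp
    then have "act f (take j (?x n k)) = take j (?y n k)" using act_take that(1,3) N(2) by auto
    then show ?thesis using that(4) by (simp add: take_map)
  qed
  have window: "\<exists>f\<in>N. gdom G f = head E (x n) \<and> act f (?x n k) = ?y n k" for n k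
  proof -
    \<comment> \<open>The window is enlarged until its right end reaches \<open>m0\<close>, where
      the hypothesis applies; the successor keeps it nonempty.\<close>
    let ?k = "Suc (max k (nat (m0 - n)))"
    let ?m = "n + int ?k - 1"
    have "m0 \<le> ?m" by simp
    then have "(left_part x ?m, left_part y ?m) \<in> ae_left E G act" using L by blast
    then have "\<forall>i<0. \<exists>f\<in>N. gdom G f = head E (left_part x ?m i) \<and>
        act f (map (left_part x ?m) [i..-1]) = map (left_part y ?m) [i..-1]"
      using ae_left_iff_nucleus[OF N] by blast
    from this[rule_format, of "- int ?k"] obtain f where f: "f \<in> N"
      "gdom G f = head E (left_part x ?m (- int ?k))"
      "act f (map (left_part x ?m) [- int ?k..-1]) = map (left_part y ?m) [- int ?k..-1]"
      by auto
    have k: "- int ?k < 0" "?m + 1 + - int ?k = n" "nat (- (- int ?k)) = ?k" by simp_all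
    have "gdom G f = head E (x n)" using f(2) k by (simp add: left_part_def)
    moreover have "act f (?x n ?k) = ?y n ?k"
      using f(3) unfolding map_left_part[OF k(1)] k .
    ultimately show ?thesis using mono[OF f(1)] f(1) by (meson le_SucI max.cobounded1)
  qed
  have "\<exists>f\<in>N. gdom G f = head E (x n) \<and> (\<forall>k. act f (?x n k) = ?y n k)" for n
  proof (rule ccontr)
    let ?P = "\<lambda>f k. gdom G f = head E (x n) \<and> act f (?x n k) = ?y n k"
    assume "\<not> ?thesis"
    then have "\<forall>f\<in>N. \<exists>k. \<not> ?P f k" by blast
    \<comment> \<open>If each \<open>f\<close> failed on some window, an arrow correct on the
      longest of these windows would be correct on its own failing one.\<close>
    then obtain \<kappa> where \<kappa>: "\<And>f. f \<in> N \<Longrightarrow> \<not> ?P f (\<kappa> f)" using bchoice[of N "\<lambda>f k. \<not> ?P f k"] by blast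
    obtain f where f: "f \<in> N" "?P f (Max (\<kappa> ` N))" using window by blast
    then have "\<kappa> f \<le> Max (\<kappa> ` N)" using N(1) by simp
    then show False using mono[OF f(1)] f \<kappa>[OF f(1)] by blast
  qed
  then have "\<forall>n. \<exists>f. f \<in> N \<and> gdom G f = head E (x n) \<and> (\<forall>k. act f (?x n k) = ?y n k)" by blast
  then obtain g where g: "\<And>n. g n \<in> N" "\<And>n. gdom G (g n) = head E (x n)"
    "\<And>n k. act (g n) (?x n k) = ?y n k" unfolding choice_iff by blast
  have "range g \<subseteq> N" using g(1) by blast
  then have "range g \<subseteq> arrows G" "finite (range g)" using N(1,2) finite_subset by blast+
  moreover have "act_right_inf act (g n) (\<lambda>k. x (n + int k)) = (\<lambda>k. y (n + int k))" for n
    by (rule act_right_inf_eqI) (use g N(2) in auto)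
  ultimately show "(x, y) \<in> ae_bi E G act"
    using x y g(2) unfolding ae_bi_def mem_Collect_eq case_prod_conv
    by (intro conjI exI[of _ g]) simp_all
qed (use ae_bi_imp_ae_left in blast)

section \<open>Separation in the limit space\<close>

text \<open>By \<open>ae_left_iff_nucleus\<close>, inequivalence is witnessed by a single window, so
  it persists for all pairs of paths agreeing with the given ones there. The original definition,
  which asks for a whole sequence of arrows, does not show this.\<close>

lemma closedin_ae_left:
  assumes E: "fin_digraph E" and con: "contracting E G act"
  shows "closedin (prod_topology (left_inf_topology E) (left_inf_topology E)) (ae_left E G act)"
proof -
  interpret fin_digraph E by fact
  let ?T = "left_inf_topology E" and ?L = "left_inf_paths E"
  obtain N where N: "finite N" "N \<subseteq> arrows G"
    "\<And>g. g \<in> arrows G \<Longrightarrow> \<exists>k. \<forall>p\<in>paths_to E (gdom G g). k \<le> length p \<longrightarrow>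
       path_restriction E G act g p \<in> N"
    using contracting_nucleus[OF E con] by blast
  note ae = ae_left_iff_nucleus[OF N]
  have L: "?L \<subseteq> {..<0} \<rightarrow>\<^sub>E arcs E" by (auto simp: left_inf_paths_def)
  have tail_open: "openin ?T {u \<in> ?L. map u [n..-1] = map x [n..-1]}" for x n
  proof -
    have "\<exists>K. finite K \<and> K \<subseteq> {..<0} \<and> (\<forall>y\<in>?L. (\<forall>i\<in>K. y i = z i) \<longrightarrow>
        y \<in> {u \<in> ?L. map u [n..-1] = map x [n..-1]})"
      if "z \<in> {u \<in> ?L. map u [n..-1] = map x [n..-1]}" for z
      using that by (intro exI[of _ "{n..-1}"]) auto
    then show ?thesis
      unfolding left_inf_topology_eq[OF wf_digraph] openin_subtopology_product_discrete[OF L] by blast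
  qed
  have "openin (prod_topology ?T ?T) (?L \<times> ?L - ae_left E G act)"
    unfolding openin_prod_topology_alt
  proof (intro allI impI)
    fix x y assume xy: "(x, y) \<in> ?L \<times> ?L - ae_left E G act"
    then obtain n where n: "n < 0"
      "\<not> (\<exists>f\<in>N. gdom G f = head E (x n) \<and> act f (map x [n..-1]) = map y [n..-1])"
      using ae by blast
    let ?U = "\<lambda>x. {u \<in> ?L. map u [n..-1] = map x [n..-1]}"
    have "(u, v) \<notin> ae_left E G act" if "u \<in> ?U x" "v \<in> ?U y" for u v
    proof -
      have "u n = x n" "map u [n..-1] = map x [n..-1]" "map v [n..-1] = map y [n..-1]"
        using that n(1) by (simp_all add: upto_rec1)
      then have "\<not> (\<exists>f\<in>N. gdom G f = head E (u n) \<and> act f (map u [n..-1]) = map v [n..-1])"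
        using n(2) by (simp only: simp_thms)
      then show ?thesis using ae n(1) by blast
    qed
    then show "\<exists>U V. openin ?T U \<and> openin ?T V \<and> x \<in> U \<and> y \<in> V \<and>
        U \<times> V \<subseteq> ?L \<times> ?L - ae_left E G act"
      using xy tail_open by (intro exI[of _ "?U x"] exI[of _ "?U y"]) auto
  qed
  moreover have "ae_left E G act \<subseteq> ?L \<times> ?L" by (auto simp: ae_left_def)
  ultimately show ?thesis
    by (simp add: closedin_def topspace_left_inf_topology[OF wf_digraph])
qed

lemma Hausdorff_space_limit_space:
  assumes E: "fin_digraph E" and con: "contracting E G act"
  shows "Hausdorff_space (limit_space E G act)"
proof -
  interpret fin_digraph E by fact
  show ?thesis
    unfolding limit_space_def
    using equiv_ae_left[OF E] topspace_left_inf_topology[OF wf_digraph]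
    by (intro Hausdorff_space_quotient_topology compact_Hausdorff_left_inf[OF E]
        closedin_ae_left[OF E con]) simp
qed

lemma topspace_limit_space:
  assumes "wf_digraph E"
  shows "topspace (limit_space E G act) = left_inf_paths E // ae_left E G act"
  using quotient_imp_surjective_map[OF quotient_map_quotient_topology[of "left_inf_topology E" "ae_left E G act"]]
  by (auto simp: limit_space_def topspace_left_inf_topology[OF assms] quotient_def)

lemma continuous_map_class_left_part:
  assumes "wf_digraph E"
  shows "continuous_map (bi_inf_topology E) (limit_space E G act)
    (\<lambda>x. ae_left E G act `` {left_part x n})"
  using continuous_map_compose[OF continuous_map_left_part[OF assms]
      quotient_imp_continuous_map[OF quotient_map_quotient_topology]]
  unfolding limit_space_def o_def .

lemma limit_shift_class_left_part:
  assumes "fin_digraph E" "x \<in> bi_inf_paths E"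
  shows "limit_shift E G act (ae_left E G act `` {left_part x n})
    = ae_left E G act `` {left_part x (n - 1)}"
  using limit_shift_class[OF assms(1) left_part_in[OF assms(2)]] by (simp add: left_shift_left_part)

section \<open>Realising points of the inverse limit by bi-infinite paths\<close>

text \<open>Representatives of the coordinates of \<xi> need not extend one another, so no path can
  be read off directly. Extending one representative to the right settles finitely many coordinates,
  and compactness of the bi-infinite path space settles all of them at once.\<close>

lemma inverse_limit_ex_bi_inf_path:
  assumes E: "fin_digraph E" and src: "no_sources E" and con: "contracting E G act"
    and \<xi>: "\<xi> \<in> topspace (inverse_limit (limit_space E G act) (limit_shift E G act))"
  obtains x where "x \<in> bi_inf_paths E"
    "\<And>n. n \<ge> 1 \<Longrightarrow> ae_left E G act `` {left_part x (int n - 2)} = \<xi> n"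
proof -
  interpret fin_digraph E by fact
  let ?J = "limit_space E G act" and ?B = "bi_inf_topology E" and ?R = "ae_left E G act"
  \<comment> \<open>Nested sequences are indexed from 0 and coordinates of \<xi> from 1, hence
    \<open>Suc n\<close> and the end position \<open>int n - 1\<close>.\<close>
  let ?C = "\<lambda>n. {x \<in> bi_inf_paths E. ?R `` {left_part x (int n - 1)} = \<xi> (Suc n)}"
  have J: "\<xi> (Suc n) \<in> topspace ?J" "limit_shift E G act (\<xi> (Suc (Suc n))) = \<xi> (Suc n)" for n
  proof -
    have "\<xi> \<in> {1..} \<rightarrow>\<^sub>E topspace ?J" "\<forall>n\<ge>1. limit_shift E G act (\<xi> (n + 1)) = \<xi> n"
      using \<xi> unfolding topspace_inverse_limit by blast+
    then show "\<xi> (Suc n) \<in> topspace ?J" "limit_shift E G act (\<xi> (Suc (Suc n))) = \<xi> (Suc n)"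
      by (auto intro: PiE_mem)
  qed
  have closed: "closedin ?B (?C n)" for n
  proof -
    \<comment> \<open>Here the limit space being Hausdorff is needed: its points are closed.\<close>
    have "closedin ?J {\<xi> (Suc n)}"
      by (rule closedin_Hausdorff_singleton[OF Hausdorff_space_limit_space[OF E con] J(1)])
    from closedin_continuous_map_preimage[OF continuous_map_class_left_part[OF wf_digraph] this]
    show ?thesis unfolding topspace_bi_inf_topology[OF wf_digraph] singleton_iff .
  qed
  have ne: "?C n \<noteq> {}" for n
  proof -
    from J(1)[of n] obtain z where "z \<in> left_inf_paths E" "\<xi> (Suc n) = ?R `` {z}"
      by (auto simp: topspace_limit_space[OF wf_digraph] quotient_def)
    moreover obtain x where "x \<in> bi_inf_paths E" "left_part x (int n - 1) = z"
      using ex_right_extension[OF wf_digraph src \<open>z \<in> left_inf_paths E\<close>] .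
    ultimately show ?thesis by blast
  qed
  have dec: "decseq ?C"
  proof (rule decseq_SucI, rule subsetI)
    fix n x assume "x \<in> ?C (Suc n)"
    then have x: "x \<in> bi_inf_paths E" "?R `` {left_part x (int n)} = \<xi> (Suc (Suc n))" by simp_all
    \<comment> \<open>Applying the shift to the coordinate already matched gives the previous one,
      by the compatibility of \<xi>.\<close>
    then have "?R `` {left_part x (int n - 1)} = \<xi> (Suc n)"
      using limit_shift_class_left_part[OF E x(1), of "int n"] J(2)[of n] by simp
    with x(1) show "x \<in> ?C n" by simp
  qed
  from compact_space_imp_nest[OF compact_bi_inf[OF E] closed ne dec]
  obtain x where x: "x \<in> bi_inf_paths E"
    "\<And>n. ?R `` {left_part x (int n - 1)} = \<xi> (Suc n)" by auto
  show thesis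
  proof (rule that[OF x(1)])
    fix n :: nat assume "n \<ge> 1"
    then show "?R `` {left_part x (int n - 2)} = \<xi> n" using x(2)[of "n - 1"] by (simp add: of_nat_diff)
  qed
qed

end

section \<open>The homeomorphism and its compatibility with the shifts\<close>

theorem proposition5p4:
  fixes E :: "('v, 'e) pre_digraph" and G :: "('g, 'v) groupoid"
    and act :: "'g \<Rightarrow> 'e list \<Rightarrow> 'e list"
  assumes "fin_digraph E" and "no_sinks E" and "no_sources E"
    and "self_similar_groupoid_action E G act" and "contracting E G act"
  shows "\<exists>\<theta>. homeomorphic_map (limit_solenoid E G act)
        (inverse_limit (limit_space E G act) (limit_shift E G act)) \<theta> \<and>
      (\<forall>x\<in>bi_inf_paths E. \<theta> (ae_bi E G act `` {x}) =
        (\<lambda>n\<in>{1..}. ae_left E G act `` {left_part x (int n - 2)})) \<and>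
      (\<forall>x\<in>bi_inf_paths E. \<theta> (ae_bi E G act `` {bi_shift x}) =
        inverse_limit_shift (limit_shift E G act) (\<theta> (ae_bi E G act `` {x})))"
proof -
  note E = assms(1) and con = assms(5)
  interpret self_similar_groupoid_action E G act by fact
  interpret fin_digraph E by fact
  let ?J = "limit_space E G act" and ?B = "bi_inf_topology E" and ?S = "limit_solenoid E G act"
  let ?I = "inverse_limit ?J (limit_shift E G act)"
  let ?q = "\<lambda>x. ae_bi E G act `` {x}"
  let ?f = "\<lambda>x. (\<lambda>n\<in>{1::nat..}. ae_left E G act `` {left_part x (int n - 2)})"
  note B = topspace_bi_inf_topology[OF wf_digraph]
  have q: "quotient_map ?B ?S ?q"
    unfolding limit_solenoid_def by (rule quotient_map_quotient_topology)
  \<comment> \<open>One direction makes \<open>?f\<close> descend to the solenoid, the other makes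
    the induced map injective.\<close>
  have fq: "?f x = ?f y \<longleftrightarrow> ?q x = ?q y" if x: "x \<in> bi_inf_paths E" and y: "y \<in> bi_inf_paths E" for x y
  proof -
    have "?f x = ?f y \<longleftrightarrow> (\<forall>n\<ge>1. (left_part x (int n - 2), left_part y (int n - 2)) \<in> ae_left E G act)"
      using eq_equiv_class_iff[OF equiv_ae_left[OF E] left_part_in[OF x] left_part_in[OF y]]
      by (auto simp: restrict_def fun_eq_iff)
    \<comment> \<open>Substituting \<open>m\<close> for \<open>int n - 2\<close> brings the
      condition into the form of \<open>ae_bi_iff_ae_left\<close> with \<open>m0\<close> equal to
      -1.\<close>
    also have "\<dots> \<longleftrightarrow> (\<forall>m\<ge>-1. (left_part x m, left_part y m) \<in> ae_left E G act)"
    proof (intro iffI allI impI)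
      fix m :: int
      assume *: "\<forall>n::nat\<ge>1. (left_part x (int n - 2), left_part y (int n - 2)) \<in> ae_left E G act"
        and "-1 \<le> m"
      then show "(left_part x m, left_part y m) \<in> ae_left E G act"
        using *[rule_format, of "nat (m + 2)"] by simp
    qed auto
    also have "\<dots> \<longleftrightarrow> ?q x = ?q y"
      using ae_bi_iff_ae_left[OF E con x y] eq_equiv_class_iff[OF equiv_ae_bi[OF E] x y] by blast
    finally show ?thesis .
  qed
  have "continuous_map ?B ?I ?f"
    unfolding inverse_limit_def continuous_map_in_subtopology
  proof
    show "continuous_map ?B (product_topology (\<lambda>_. ?J) {1..}) ?f"
      unfolding continuous_map_componentwise
      using continuous_map_class_left_part[OF wf_digraph] by auto
    show "?f \<in> topspace ?B \<rightarrow> {\<xi>. \<forall>n\<ge>1. limit_shift E G act (\<xi> (n + 1)) = \<xi> n}"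
      using limit_shift_class_left_part[OF E] by (auto simp: B)
  qed
  moreover have "?f x = ?f y" if "x \<in> topspace ?B" "y \<in> topspace ?B" "?q x = ?q y" for x y
    using that fq unfolding B by blast
  ultimately obtain \<theta> where \<theta>: "continuous_map ?S ?I \<theta>"
    "\<theta> ` topspace ?S = ?f ` topspace ?B" "\<And>x. x \<in> topspace ?B \<Longrightarrow> \<theta> (?q x) = ?f x"
    by (rule quotient_map_lift_exists[OF q]) blast+
  have S: "topspace ?S = ?q ` bi_inf_paths E" using quotient_imp_surjective_map[OF q] B by simp
  have "homeomorphic_map ?S ?I \<theta>"
  \<comment> \<open>Compactness of the source and separation of the target make continuity of the
    inverse automatic.\<close>
  proof (rule continuous_imp_homeomorphic_map[OF \<theta>(1)])
    show "compact_space ?S"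
      using image_compactin[OF _ quotient_imp_continuous_map[OF q]] compact_bi_inf[OF E]
        quotient_imp_surjective_map[OF q] unfolding compact_space_def by metis
    show "Hausdorff_space ?I"
      unfolding inverse_limit_def
      by (intro Hausdorff_space_subtopology)
        (simp add: Hausdorff_space_product_topology Hausdorff_space_limit_space[OF E con])
    have "\<xi> \<in> ?f ` topspace ?B" if "\<xi> \<in> topspace ?I" for \<xi>
    proof -
      obtain x where x: "x \<in> bi_inf_paths E"
        "\<And>n. n \<ge> 1 \<Longrightarrow> ae_left E G act `` {left_part x (int n - 2)} = \<xi> n"
        using inverse_limit_ex_bi_inf_path[OF E assms(3) con \<open>\<xi> \<in> topspace ?I\<close>] by blast
      have "\<xi> \<in> extensional {1..}" using that unfolding topspace_inverse_limit PiE_def by blast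
      then have "?f x = \<xi>" using x(2) by (intro extensionalityI[of _ "{1..}"]) auto
      then show ?thesis using x(1) B by blast
    qed
    then show "\<theta> ` topspace ?S = topspace ?I"
      using continuous_map_image_subset_topspace[OF \<theta>(1)] \<theta>(2) by blast
    show "inj_on \<theta> (topspace ?S)"
      using \<theta>(3) fq unfolding S B by (auto simp: inj_on_def)
  qed
  moreover have "\<theta> (?q (bi_shift x)) = inverse_limit_shift (limit_shift E G act) (\<theta> (?q x))"
    if x: "x \<in> bi_inf_paths E" for x
  proof -
    have "tail E (x (n - 1)) = head E (x n)" for n
      using x by (auto simp: bi_inf_paths_def dest: spec[of _ "n - 1"])
    then have "bi_shift x \<in> bi_inf_paths E"
      using x by (auto simp: bi_shift_def bi_inf_paths_def)
    \<comment> \<open>At coordinate \<open>n\<close> both sides are the class of the left part of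
      \<open>x\<close> ending at \<open>int n - 3\<close>: for \<open>n = 1\<close> it arises by
      applying \<open>limit_shift\<close>, otherwise it is coordinate \<open>n - 1\<close> of the
      image of \<open>x\<close>.\<close>
    then show ?thesis
      using \<theta>(3) x limit_shift_class_left_part[OF E x]
      by (auto simp: B left_part_bi_shift inverse_limit_shift_def fun_eq_iff of_nat_diff)
  qed
  ultimately show ?thesis using \<theta>(3) unfolding B by blast
qed

end
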